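(* Let $(X,T)$ be a topological dynamical system with a metric $d$ and let $f\in C(X,\mathbb{R})$. Then for every $\epsilon>0$ and every finite sequence $\mathcal{S}^{*}$ of $\mathbb{N}$, \begin{align*} \overline{\mathrm{mdim}}_M(T,f,X,d)&=\max_{x\in X}\overline{\mathrm{mdim}}_M^B(T,f,W_{\epsilon,\mathcal{S}^{*}}^s(x,T),d)\\ &=\max_{x\in X}\overline{\mathrm{mdim}}_M^P(T,f,W_{\epsilon,\mathcal{S}^{*}}^s(x,T),d)\\ &=\max_{x\in X}\overline{\mathrm{mdim}}_M(T,f,W_{\epsilon,\mathcal{S}^{*}}^s(x,T),d). \end{align*}
   Context: A topological dynamical system (TDS) $(X,T)$ with metric $d$: $X$ is a compact metrizable space with compatible metric $d$, and $T:X\to X$ is continuous. $C(X,\mathbb{R})$ is the space of real continuous functions with the sup norm. $\mathbb{N}=\{0,1,2,\dots\}$ for the time sequences below. Write $S_nf(x)=\sum_{j=0}^{n-1}f(T^jx)$, $d_n(x,y)=\max_{0\le j\le n-1}d(T^jx,T^jy)$, $B_n(x,\epsilon)=\{y:d_n(x,y)<\epsilon\}$, $\overline B_n(x,\epsilon)=\{y:d_n(x,y)\le\epsilon\}$. For a sequence (set of times) $\mathcal S\subset\mathbb{N}$, $W^s_{\epsilon,\mathcal S}(x,T)=\{y\in X: d(T^jx,T^jy)\le\epsilon \text{ for all } j\in\mathcal S\}$. Upper metric mean dimension with potential. For non-empty $Z\subset X$, a set $E\subset X$ is an $(n,\epsilon)$-spanning set of $Z$ if every $x\in Z$ has some $y\in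 E$ with $d_n(x,y)<\epsilon$. Put $P_n(T,f,Z,d,\epsilon)=\inf\{\sum_{x\in E}(1/\epsilon)^{S_nf(x)}\}$ over all $(n,\epsilon)$-spanning sets $E$ of $Z$, $P(T,f,Z,d,\epsilon)=\limsup_{n\to\infty}\frac1n\log P_n(T,f,Z,d,\epsilon)$, and $\overline{\mathrm{mdim}}_M(T,f,Z,d)=\limsup_{\epsilon\to0}\frac{P(T,f,Z,d,\epsilon)}{\log\frac1\epsilon}$. Bowen upper metric mean dimension with potential. For $s\in\mathbb{R}$, $N\in\mathbb{N}$, $\epsilon>0$, let $M^s_{N,\epsilon}(T,f,Z,d)=\inf\{\sum_{i\in I}e^{-n_is+\log\frac1\epsilon\cdot S_{n_i}f(x_i)}\}$ over all finite or countable covers $\{B_{n_i}(x_i,\epsilon)\}_{i\in I}$ of $Z$ with $n_i\ge N$, $x_i\in X$; $M^s_\epsilon(T,f,Z,d)=\lim_{N\to\infty}M^s_{N,\epsilon}(T,f,Z,d)$; $M_\epsilon(T,f,Z,d)=\inf\{s:M^s_\epsilon(T,f,Z,d)=0\}=\sup\{s:M^s_\epsilon(T,f,Z,d)=\infty\}$; $\overline{\mathrm{mdim}}_M^B(T,f,Z,d)=\limsup_{\epsilon\to0}\frac{M_\epsilon(T,f,Z,d)}{\log\frac1\epsilon}$. Packing upper metric mean dimension with potential. Let $P^s_{N,\epsilon}(T,f,Z,d)=\sup\{\sum_{i\in I}e^{-n_is+\log\frac1\epsilon\cdot S_{n_i}f(x_i)}\}$ over all finite or countable pairwise disjoint families $\{\overline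 B_{n_i}(x_i,\epsilon)\}_{i\in I}$ with $n_i\ge N$, $x_i\in Z$; $P^s_\epsilon(T,f,Z,d)=\lim_{N\to\infty}P^s_{N,\epsilon}(T,f,Z,d)$; $\mathcal P^s_\epsilon(T,f,Z,d)=\inf\{\sum_{i\ge1}P^s_\epsilon(T,f,Z_i,d):\bigcup_{i\ge1}Z_i\supseteq Z\}$; $\mathcal P_\epsilon(T,f,Z,d)=\inf\{s:\mathcal P^s_\epsilon(T,f,Z,d)=0\}=\sup\{s:\mathcal P^s_\epsilon(T,f,Z,d)=\infty\}$; $\overline{\mathrm{mdim}}_M^P(T,f,Z,d)=\limsup_{\epsilon\to0}\frac{\mathcal P_\epsilon(T,f,Z,d)}{\log\frac1\epsilon}$. *)

theory Defs
  imports "HOL-Analysis.Analysis"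
begin

text \<open>
  The phase space is the whole carrier of a type of class \<^class>\<open>metric_space\<close> (assumed compact
  in theorems), and the metric is \<^const>\<open>dist\<close>.
\<close>

definition birkhoff_sum :: "('a \<Rightarrow> 'a) \<Rightarrow> ('a \<Rightarrow> real) \<Rightarrow> nat \<Rightarrow> 'a \<Rightarrow> real" where
  "birkhoff_sum T f n x = (\<Sum>j<n. f ((T ^^ j) x))"

text \<open>
  For \<open>n = 0\<close> the maximum is over the empty set and its value is unspecified.  Below, this value
  only enters terms with index \<open>0\<close> of sequences of which only the limit or upper limit is used.
\<close>

definition bowen_dist :: "('a::metric_space \<Rightarrow> 'a) \<Rightarrow> nat \<Rightarrow> 'a \<Rightarrow> 'a \<Rightarrow> real" where
  "bowen_dist T n x y = Max ((\<lambda>j. dist ((T ^^ j) x) ((T ^^ j) y)) ` {..<n})"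

definition bowen_ball :: "('a::metric_space \<Rightarrow> 'a) \<Rightarrow> nat \<Rightarrow> 'a \<Rightarrow> real \<Rightarrow> 'a set" where
  "bowen_ball T n x \<epsilon> = {y. bowen_dist T n x y < \<epsilon>}"

definition bowen_cball :: "('a::metric_space \<Rightarrow> 'a) \<Rightarrow> nat \<Rightarrow> 'a \<Rightarrow> real \<Rightarrow> 'a set" where
  "bowen_cball T n x \<epsilon> = {y. bowen_dist T n x y \<le> \<epsilon>}"

definition stable_set :: "('a::metric_space \<Rightarrow> 'a) \<Rightarrow> real \<Rightarrow> nat set \<Rightarrow> 'a \<Rightarrow> 'a set" where
  "stable_set T \<epsilon> S x = {y. \<forall>j\<in>S. dist ((T ^^ j) x) ((T ^^ j) y) \<le> \<epsilon>}"


subsection \<open>Upper metric mean dimension with potential\<close>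

definition ln_ennreal :: "ennreal \<Rightarrow> ereal" where
  "ln_ennreal u = (if u = 0 then - \<infinity> else if u = \<infinity> then \<infinity> else ereal (ln (enn2real u)))"

definition spanning :: "('a::metric_space \<Rightarrow> 'a) \<Rightarrow> nat \<Rightarrow> real \<Rightarrow> 'a set \<Rightarrow> 'a set \<Rightarrow> bool" where
  "spanning T n \<epsilon> Z E \<longleftrightarrow> (\<forall>x\<in>Z. \<exists>y\<in>E. bowen_dist T n x y < \<epsilon>)"

text \<open>
  Spanning sets may be infinite, even uncountable: an unordered sum in \<^typ>\<open>ennreal\<close> always
  exists, as the supremum of its finite partial sums.
\<close>

definition span_sum ::
    "('a::metric_space \<Rightarrow> 'a) \<Rightarrow> ('a \<Rightarrow> real) \<Rightarrow> 'a set \<Rightarrow> real \<Rightarrow> nat \<Rightarrow> ennreal" where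
  "span_sum T f Z \<epsilon> n =
     (INF E\<in>{E. spanning T n \<epsilon> Z E}. \<Sum>\<^sub>\<infinity>x\<in>E. ennreal ((1 / \<epsilon>) powr birkhoff_sum T f n x))"

definition span_pressure ::
    "('a::metric_space \<Rightarrow> 'a) \<Rightarrow> ('a \<Rightarrow> real) \<Rightarrow> 'a set \<Rightarrow> real \<Rightarrow> ereal" where
  "span_pressure T f Z \<epsilon> = limsup (\<lambda>n. ln_ennreal (span_sum T f Z \<epsilon> n) / ereal (real n))"

definition upper_mdim ::
    "('a::metric_space \<Rightarrow> 'a) \<Rightarrow> ('a \<Rightarrow> real) \<Rightarrow> 'a set \<Rightarrow> ereal" where
  "upper_mdim T f Z =
     Limsup (at_right 0) (\<lambda>\<epsilon>. span_pressure T f Z \<epsilon> / ereal (ln (1 / \<epsilon>)))"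


subsection \<open>Bowen upper metric mean dimension with potential\<close>

definition weighted_sum ::
    "('a \<Rightarrow> 'a) \<Rightarrow> ('a \<Rightarrow> real) \<Rightarrow> real \<Rightarrow> real \<Rightarrow> nat set \<Rightarrow> (nat \<Rightarrow> nat) \<Rightarrow> (nat \<Rightarrow> 'a) \<Rightarrow> ennreal" where
  "weighted_sum T f s \<epsilon> I n x =
     (\<Sum>\<^sub>\<infinity>i\<in>I. ennreal (exp (- real (n i) * s + ln (1 / \<epsilon>) * birkhoff_sum T f (n i) (x i))))"

text \<open>Finite or countable families are indexed by arbitrary subsets of \<^typ>\<open>nat\<close>.\<close>

definition bowen_pre ::
    "('a::metric_space \<Rightarrow> 'a) \<Rightarrow> ('a \<Rightarrow> real) \<Rightarrow> 'a set \<Rightarrow> real \<Rightarrow> real \<Rightarrow> nat \<Rightarrow> ennreal" where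
  "bowen_pre T f Z \<epsilon> s N =
     Inf {weighted_sum T f s \<epsilon> I n x | I n x.
            (\<forall>i\<in>I. N \<le> n i) \<and> Z \<subseteq> (\<Union>i\<in>I. bowen_ball T (n i) (x i) \<epsilon>)}"

definition bowen_outer ::
    "('a::metric_space \<Rightarrow> 'a) \<Rightarrow> ('a \<Rightarrow> real) \<Rightarrow> 'a set \<Rightarrow> real \<Rightarrow> real \<Rightarrow> ennreal" where
  "bowen_outer T f Z \<epsilon> s = lim (\<lambda>N. bowen_pre T f Z \<epsilon> s N)"

definition bowen_pressure ::
    "('a::metric_space \<Rightarrow> 'a) \<Rightarrow> ('a \<Rightarrow> real) \<Rightarrow> 'a set \<Rightarrow> real \<Rightarrow> ereal" where
  "bowen_pressure T f Z \<epsilon> = Inf (ereal ` {s. bowen_outer T f Z \<epsilon> s = 0})"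

definition bowen_upper_mdim ::
    "('a::metric_space \<Rightarrow> 'a) \<Rightarrow> ('a \<Rightarrow> real) \<Rightarrow> 'a set \<Rightarrow> ereal" where
  "bowen_upper_mdim T f Z =
     Limsup (at_right 0) (\<lambda>\<epsilon>. bowen_pressure T f Z \<epsilon> / ereal (ln (1 / \<epsilon>)))"


subsection \<open>Packing upper metric mean dimension with potential\<close>

definition packing_pre ::
    "('a::metric_space \<Rightarrow> 'a) \<Rightarrow> ('a \<Rightarrow> real) \<Rightarrow> 'a set \<Rightarrow> real \<Rightarrow> real \<Rightarrow> nat \<Rightarrow> ennreal" where
  "packing_pre T f Z \<epsilon> s N =
     Sup {weighted_sum T f s \<epsilon> I n x | I n x.
            (\<forall>i\<in>I. N \<le> n i \<and> x i \<in> Z) \<and>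
            disjoint_family_on (\<lambda>i. bowen_cball T (n i) (x i) \<epsilon>) I}"

definition packing_premeasure ::
    "('a::metric_space \<Rightarrow> 'a) \<Rightarrow> ('a \<Rightarrow> real) \<Rightarrow> 'a set \<Rightarrow> real \<Rightarrow> real \<Rightarrow> ennreal" where
  "packing_premeasure T f Z \<epsilon> s = lim (\<lambda>N. packing_pre T f Z \<epsilon> s N)"

definition packing_outer ::
    "('a::metric_space \<Rightarrow> 'a) \<Rightarrow> ('a \<Rightarrow> real) \<Rightarrow> 'a set \<Rightarrow> real \<Rightarrow> real \<Rightarrow> ennreal" where
  "packing_outer T f Z \<epsilon> s =
     (INF Y\<in>{Y :: nat \<Rightarrow> 'a set. Z \<subseteq> (\<Union>i. Y i)}. \<Sum>i. packing_premeasure T f (Y i) \<epsilon> s)"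

definition packing_pressure ::
    "('a::metric_space \<Rightarrow> 'a) \<Rightarrow> ('a \<Rightarrow> real) \<Rightarrow> 'a set \<Rightarrow> real \<Rightarrow> ereal" where
  "packing_pressure T f Z \<epsilon> = Inf (ereal ` {s. packing_outer T f Z \<epsilon> s = 0})"

definition packing_upper_mdim ::
    "('a::metric_space \<Rightarrow> 'a) \<Rightarrow> ('a \<Rightarrow> real) \<Rightarrow> 'a set \<Rightarrow> ereal" where
  "packing_upper_mdim T f Z =
     Limsup (at_right 0) (\<lambda>\<epsilon>. packing_pressure T f Z \<epsilon> / ereal (ln (1 / \<epsilon>)))"


text \<open>The family attains its maximum over all \<open>x\<close>, and the maximum is \<open>m\<close>.\<close>

definition is_max_of :: "ereal \<Rightarrow> ('a \<Rightarrow> ereal) \<Rightarrow> bool" where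
  "is_max_of m g \<longleftrightarrow> (\<exists>x. g x = m) \<and> (\<forall>x. g x \<le> m)"

end

theory Submission
  imports Defs
begin

text \<open>
  For every \<open>Z\<close> the Bowen dimension is at most the packing dimension (a maximal disjoint family of
  closed balls of radius \<open>\<epsilon>\<close> covers after enlarging the radius to \<open>3\<epsilon>\<close>, and the Bowen outer measure
  is countably subadditive), and the packing dimension is at most the spanning one (centres of
  disjoint balls of equal length inject into any spanning set).  On the whole space Bowen's
  concatenation argument gives the reverse inequality: if a finite cover by Bowen balls has weighted
  sum at most \<open>1\<close>, so has the family of concatenations of its members stopped as soon as their length
  reaches \<open>N\<close>, and this yields an efficient \<open>(N, 2\<epsilon>)\<close>-spanning set.  Changing the radius by a
  constant factor and replacing \<open>f\<close> by its values at nearby points costs only \<open>o(log (1/\<epsilon>))\<close>, which disappears in the upper limit.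

  Finitely many sets \<open>W(x)\<close> cover the space, by continuity and finiteness of the set of times.  As the
  Bowen dimension is finitely stable, it attains the dimension of the whole space on one of them,
  and there all three quantities are squeezed to this value.
\<close>

subsection \<open>Limits and Bowen balls\<close>

text \<open>Passes from every admissible exponent \<open>s\<close> to the infimum that defines a
  pressure. As \<open>h\<close> is real, it can be moved across the inequality even when the infimum
  is infinite.\<close>

lemma le_Inf_add_ereal:
  assumes "\<And>s. s \<in> A \<Longrightarrow> P \<le> ereal (s + h)"
  shows "P \<le> Inf (ereal ` A) + ereal h"
proof -
  have "P - ereal h \<le> Inf (ereal ` A)"
    using assms by (intro INF_greatest) (simp add: ereal_minus_le)
  then show ?thesis by (simp add: ereal_minus_le)
qed

text \<open>The counterpart for a pressure that is an upper limit: it is tested against the reals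
  strictly above it, which also covers the value \<open>-\<infinity>\<close>.\<close>

lemma le_add_ereal_dense:
  assumes "\<And>b. B < ereal b \<Longrightarrow> A \<le> ereal (b + h)"
  shows "A \<le> B + ereal h"
proof -
  have "A - ereal h \<le> B"
  proof (rule ccontr)
    assume "\<not> A - ereal h \<le> B"
    then obtain b where "B < ereal b" "ereal b < A - ereal h"
      using ereal_dense2[of B "A - ereal h"] by (auto simp: not_le)
    with assms[of b] have "\<not> A \<le> ereal b + ereal h" "A \<le> ereal b + ereal h"
      by (simp_all add: ereal_less_minus not_le)
    then show False by blast
  qed
  then show ?thesis by (simp add: ereal_minus_le)
qed

lemma eventually_ln_inverse_ge: "eventually (\<lambda>\<epsilon>::real. C \<le> ln (1 / \<epsilon>)) (at_right 0)"
proof -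
  have "eventually (\<lambda>\<epsilon>::real. \<epsilon> < exp (- C)) (at_right 0)"
    by (rule eventually_at_rightI[of 0 "exp (-C)"]) auto
  moreover have "eventually (\<lambda>\<epsilon>::real. 0 < \<epsilon>) (at_right 0)"
    by (simp add: eventually_at_right_less)
  ultimately show ?thesis
  proof eventually_elim
    case (elim \<epsilon>)
    then have "ln \<epsilon> \<le> ln (exp (- C))" by (subst ln_le_cancel_iff) auto
    with elim show ?case by (simp add: ln_div)
  qed
qed

text \<open>\<open>ln (1 / (c * \<epsilon>))\<close> and \<open>ln (1 / \<epsilon>)\<close> differ
  by the constant \<open>ln c\<close>, so their quotient tends to 1; after division the error term
  contributes only \<open>\<eta>\<close>, which is arbitrary.\<close>

lemma Limsup_div_ln_le:
  fixes A B :: "real \<Rightarrow> ereal"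
  assumes "c > 0"
    and ev: "\<And>\<eta>. \<eta> > 0 \<Longrightarrow>
      eventually (\<lambda>\<epsilon>. A (c * \<epsilon>) \<le> B \<epsilon> + ereal (\<eta> * ln (1 / \<epsilon>))) (at_right 0)"
  shows "Limsup (at_right 0) (\<lambda>\<epsilon>. A \<epsilon> / ereal (ln (1 / \<epsilon>)))
    \<le> Limsup (at_right 0) (\<lambda>\<epsilon>. B \<epsilon> / ereal (ln (1 / \<epsilon>)))"
    (is "?A \<le> ?B")
proof (rule ccontr)
  assume "\<not> ?A \<le> ?B"
  then obtain b where b: "?B < ereal b" "ereal b < ?A"
    using ereal_dense2[of ?B ?A] by (auto simp: not_le)
  then obtain b' where b': "ereal b < ereal b'" "ereal b' < ?A"
    using ereal_dense2[of "ereal b" ?A] by auto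
  \<comment> \<open>One half of the gap \<open>b' - b\<close> pays for the error term in
    \<open>ev\<close>, the other for the change of denominator from
    \<open>ln (1 / \<epsilon>)\<close> to \<open>ln (1 / (c * \<epsilon>))\<close>.\<close>
  define \<eta> where "\<eta> = (b' - b) / 2"
  have \<eta>: "\<eta> > 0" "b' = b + 2 * \<eta>"
    using b' by (auto simp: \<eta>_def field_simps)
  have "eventually (\<lambda>\<epsilon>. B \<epsilon> / ereal (ln (1 / \<epsilon>)) < ereal b) (at_right 0)"
    using b(1) by (rule Limsup_lessD)
  moreover have "eventually (\<lambda>\<epsilon>::real. 1 \<le> ln (1 / \<epsilon>)) (at_right 0)"
    by (rule eventually_ln_inverse_ge)
  \<comment> \<open>Keeps the new denominator \<open>ln (1 / (c * \<epsilon>))\<close> at least 1,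
    so that dividing by it preserves the order.\<close>
  moreover have "eventually (\<lambda>\<epsilon>::real. 1 + ln c \<le> ln (1 / \<epsilon>)) (at_right 0)"
    by (rule eventually_ln_inverse_ge)
  moreover have "eventually (\<lambda>\<epsilon>::real. (b' * ln c) / \<eta> \<le> ln (1 / \<epsilon>)) (at_right 0)"
    by (rule eventually_ln_inverse_ge)
  moreover have "eventually (\<lambda>\<epsilon>::real. 0 < \<epsilon>) (at_right 0)"
    by (simp add: eventually_at_right_less)
  ultimately have "eventually (\<lambda>\<epsilon>. A (c * \<epsilon>) / ereal (ln (1 / (c * \<epsilon>))) \<le> ereal b') (at_right 0)"
    using ev[OF \<eta>(1)]
  proof eventually_elim
    case (elim \<epsilon>)
    have "B \<epsilon> < ereal (b * ln (1 / \<epsilon>))"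
      using elim(1,2) by (subst (asm) ereal_divide_less_pos) (auto simp: mult.commute)
    then have "A (c * \<epsilon>) \<le> ereal (b * ln (1 / \<epsilon>)) + ereal (\<eta> * ln (1 / \<epsilon>))"
      using elim(6) by (meson add_right_mono less_imp_le order_trans)
    also have "\<dots> \<le> ereal (b' * ln (1 / (c * \<epsilon>)))"
    proof -
      have "b' * ln c \<le> \<eta> * ln (1 / \<epsilon>)"
        using elim(4) \<eta>(1) by (simp add: pos_divide_le_eq mult.commute)
      then show ?thesis
        using elim(5) assms(1) unfolding \<eta>(2) by (simp add: ln_div ln_mult algebra_simps)
    qed
    finally show ?case
      using elim(3,5) assms(1)
      by (subst ereal_divide_le_pos) (auto simp: ln_div ln_mult mult.commute)
  qed
  \<comment> \<open>The bound is known at the radii \<open>c * \<epsilon>\<close>; scaling by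
    \<open>c\<close> carries the filter onto itself.\<close>
  moreover have "at_right (0::real) = filtermap (times c) (at_right 0)"
    using filtermap_times_pos_at_right[OF assms(1), of 0] by simp
  ultimately have "eventually (\<lambda>\<epsilon>. A \<epsilon> / ereal (ln (1 / \<epsilon>)) \<le> ereal b') (at_right 0)"
    by (metis (mono_tags, lifting) eventually_filtermap eventually_mono)
  then have "?A \<le> ereal b'" by (rule Limsup_bounded)
  with b'(2) show False by simp
qed

section \<open>Bowen balls and compactness\<close>

lemma bowen_dist_less_iff:
  "n > 0 \<Longrightarrow> bowen_dist T n x y < e \<longleftrightarrow> (\<forall>j<n. dist ((T ^^ j) x) ((T ^^ j) y) < e)"
  unfolding bowen_dist_def by (subst Max_less_iff) auto

lemma bowen_dist_le_iff:
  "n > 0 \<Longrightarrow> bowen_dist T n x y \<le> e \<longleftrightarrow> (\<forall>j<n. dist ((T ^^ j) x) ((T ^^ j) y) \<le> e)"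
  unfolding bowen_dist_def by (subst Max_le_iff) auto

lemma continuous_on_funpow:
  fixes T :: "'a::topological_space \<Rightarrow> 'a"
  assumes "continuous_on UNIV T"
  shows "continuous_on UNIV (T ^^ j)"
proof (induction j)
  case (Suc j)
  then show ?case
    using continuous_on_compose2[OF assms Suc] by (simp add: o_def)
qed simp

lemma open_bowen_ball:
  assumes "continuous_on UNIV T" "n > 0"
  shows "open (bowen_ball T n x \<epsilon>)"
proof -
  have "bowen_ball T n x \<epsilon> = (\<Inter>j<n. {y. dist ((T ^^ j) x) ((T ^^ j) y) < \<epsilon>})"
    using assms(2) by (auto simp: bowen_ball_def bowen_dist_less_iff)
  moreover have "open {y. dist ((T ^^ j) x) ((T ^^ j) y) < \<epsilon>}" for j
    by (intro open_Collect_less continuous_intros continuous_on_funpow assms)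
  ultimately show ?thesis by (simp add: open_INT)
qed

lemma finite_spanning_exists:
  fixes T :: "'a::metric_space \<Rightarrow> 'a"
  assumes "compact (UNIV :: 'a set)" "continuous_on UNIV T" "n > 0" "\<epsilon> > 0"
  obtains E where "finite E" "spanning T n \<epsilon> UNIV E"
proof -
  have "(UNIV :: 'a set) \<subseteq> (\<Union>x\<in>UNIV. bowen_ball T n x \<epsilon>)"
    using assms by (auto simp: bowen_ball_def bowen_dist_less_iff)
  then obtain E where "finite E" "UNIV \<subseteq> (\<Union>x\<in>E. bowen_ball T n x \<epsilon>)"
    using compactE_image[OF assms(1), of UNIV "\<lambda>x. bowen_ball T n x \<epsilon>"] open_bowen_ball assms
    by metis
  moreover from this(2) have "spanning T n \<epsilon> UNIV E"
    unfolding spanning_def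
  proof (intro ballI)
    fix y
    obtain x where "x \<in> E" "y \<in> bowen_ball T n x \<epsilon>"
      using \<open>UNIV \<subseteq> (\<Union>x\<in>E. bowen_ball T n x \<epsilon>)\<close> by blast
    then show "\<exists>x\<in>E. bowen_dist T n y x < \<epsilon>"
      using assms(3) by (auto simp: bowen_ball_def bowen_dist_less_iff dist_commute)
  qed
  ultimately show ?thesis using that by blast
qed

section \<open>Birkhoff sums\<close>

lemma birkhoff_sum_add:
  "birkhoff_sum T f (m + n) x = birkhoff_sum T f m x + birkhoff_sum T f n ((T ^^ m) x)"
proof -
  have "(T ^^ (m + j)) x = (T ^^ j) ((T ^^ m) x)" for j
    by (simp add: add.commute[of m] funpow_add)
  then show ?thesis
    by (induction n) (simp_all add: birkhoff_sum_def add.assoc)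
qed

lemma birkhoff_sum_le_add:
  assumes "\<And>j. j < n \<Longrightarrow> f ((T ^^ j) x) \<le> f ((T ^^ j) y) + \<eta>"
  shows "birkhoff_sum T f n x \<le> birkhoff_sum T f n y + real n * \<eta>"
proof -
  have "birkhoff_sum T f n x \<le> (\<Sum>j<n. f ((T ^^ j) y) + \<eta>)"
    unfolding birkhoff_sum_def using assms by (intro sum_mono) auto
  then show ?thesis by (simp add: birkhoff_sum_def sum.distrib)
qed

lemma abs_birkhoff_sum_le:
  assumes "\<And>x. \<bar>f x\<bar> \<le> F"
  shows "\<bar>birkhoff_sum T f n x\<bar> \<le> real n * F"
proof -
  have "\<bar>birkhoff_sum T f n x\<bar> \<le> (\<Sum>j<n. F)"
    unfolding birkhoff_sum_def using assms by (intro order_trans[OF sum_abs] sum_mono) auto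
  then show ?thesis by simp
qed

section \<open>Unordered sums and logarithms of extended non-negative reals\<close>

lemma sum_le_infsum_ennreal:
  fixes f :: "'a \<Rightarrow> ennreal"
  assumes "finite F" "F \<subseteq> A"
  shows "sum f F \<le> infsum f A"
  using assms by (subst nonneg_infsum_complete) (auto intro: SUP_upper)

lemma infsum_le_ennreal:
  fixes f :: "'a \<Rightarrow> ennreal"
  assumes "\<And>F. finite F \<Longrightarrow> F \<subseteq> A \<Longrightarrow> sum f F \<le> b"
  shows "infsum f A \<le> b"
  using assms by (auto simp: nonneg_infsum_complete intro!: SUP_least)

lemma ln_ennreal_mono: "u \<le> v \<Longrightarrow> ln_ennreal u \<le> ln_ennreal v"
  by (auto simp: ln_ennreal_def top_unique enn2real_positive_iff top.not_eq_extremum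
      zero_less_iff_neq_zero intro!: enn2real_mono ln_mono)

lemma ln_ennreal_exp: "ln_ennreal (ennreal (exp a)) = ereal a"
  by (simp add: ln_ennreal_def ennreal_eq_0_iff)

text \<open>Turns growth rates into bounds on the sums themselves, with the values 0 and \<infinity>
  included.\<close>

lemma ln_ennreal_le_iff: "ln_ennreal u \<le> ereal a \<longleftrightarrow> u \<le> ennreal (exp a)"
proof
  assume *: "ln_ennreal u \<le> ereal a"
  show "u \<le> ennreal (exp a)"
  proof (cases u)
    case (real r)
    with * have "r = 0 \<or> ln r \<le> a" by (auto simp: ln_ennreal_def split: if_splits)
    with real have "r \<le> exp a"
      by (metis exp_ge_zero exp_le_cancel_iff exp_ln less_eq_real_def)
    with real show ?thesis by (simp add: ennreal_leI)
  next
    case top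
    with * show ?thesis by (simp add: ln_ennreal_def)
  qed
next
  assume "u \<le> ennreal (exp a)"
  then show "ln_ennreal u \<le> ereal a"
    using ln_ennreal_mono ln_ennreal_exp by metis
qed

section \<open>Bowen and packing set functions as monotone limits, and subadditivity\<close>

lemma LIMSEQ_bowen_pre:
  "(\<lambda>N. bowen_pre T f Z \<epsilon> s N) \<longlonglongrightarrow> bowen_outer T f Z \<epsilon> s"
  "bowen_pre T f Z \<epsilon> s N \<le> bowen_outer T f Z \<epsilon> s"
proof -
  \<comment> \<open>A larger \<open>N\<close> admits fewer covers, so the infima increase; hence the
    \<open>lim\<close> in the definition is a genuine limit and a supremum.\<close>
  have inc: "incseq (\<lambda>N. bowen_pre T f Z \<epsilon> s N)"
    unfolding bowen_pre_def by (intro incseq_SucI Inf_superset_mono) fastforce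
  have "bowen_outer T f Z \<epsilon> s = (SUP N. bowen_pre T f Z \<epsilon> s N)"
    unfolding bowen_outer_def using LIMSEQ_SUP[OF inc] by (rule limI)
  then show "(\<lambda>N. bowen_pre T f Z \<epsilon> s N) \<longlonglongrightarrow> bowen_outer T f Z \<epsilon> s"
    "bowen_pre T f Z \<epsilon> s N \<le> bowen_outer T f Z \<epsilon> s"
    using LIMSEQ_SUP[OF inc] by (auto intro: SUP_upper)
qed

lemma LIMSEQ_packing_pre:
  "(\<lambda>N. packing_pre T f Z \<epsilon> s N) \<longlonglongrightarrow> packing_premeasure T f Z \<epsilon> s"
proof -
  \<comment> \<open>A larger \<open>N\<close> admits fewer packings, so here the suprema decrease
    and the limit is an infimum.\<close>
  have dec: "decseq (\<lambda>N. packing_pre T f Z \<epsilon> s N)"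
    unfolding packing_pre_def by (intro decseq_SucI Sup_subset_mono) fastforce
  have "packing_premeasure T f Z \<epsilon> s = (INF N. packing_pre T f Z \<epsilon> s N)"
    unfolding packing_premeasure_def using LIMSEQ_INF[OF dec] by (rule limI)
  then show ?thesis using LIMSEQ_INF[OF dec] by simp
qed

lemma bowen_pre_le_weighted_sum:
  assumes "\<And>i. i \<in> I \<Longrightarrow> N \<le> n i" "Z \<subseteq> (\<Union>i\<in>I. bowen_ball T (n i) (x i) \<epsilon>)"
  shows "bowen_pre T f Z \<epsilon> s N \<le> weighted_sum T f s \<epsilon> I n x"
  unfolding bowen_pre_def using assms by (intro Inf_lower) blast

lemma bowen_pre_less:
  assumes "bowen_pre T f Z \<epsilon> s N < c"
  shows "\<exists>I n x. (\<forall>i\<in>I. N \<le> n i) \<and> Z \<subseteq> (\<Union>i\<in>I. bowen_ball T (n i) (x i) \<epsilon>) \<and>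
    weighted_sum T f s \<epsilon> I n x < c"
  using assms unfolding bowen_pre_def Inf_less_iff by auto

lemma weighted_sum_le_packing_pre:
  assumes "\<And>i. i \<in> I \<Longrightarrow> N \<le> n i" "\<And>i. i \<in> I \<Longrightarrow> x i \<in> Z"
    "disjoint_family_on (\<lambda>i. bowen_cball T (n i) (x i) \<epsilon>) I"
  shows "weighted_sum T f s \<epsilon> I n x \<le> packing_pre T f Z \<epsilon> s N"
  unfolding packing_pre_def using assms by (intro Sup_upper) blast

text \<open>The outer-measure argument: cover each \<open>Y k\<close> up to an error
  \<open>e / 2 ^ Suc k\<close> and merge all these covers.\<close>

lemma bowen_pre_subadditive:
  assumes "Z \<subseteq> (\<Union>k::nat. Y k)"
  shows "bowen_pre T f Z \<epsilon> s N \<le> (\<Sum>k. bowen_pre T f (Y k) \<epsilon> s N)"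
proof (rule ennreal_le_epsilon)
  let ?p = "\<lambda>k. bowen_pre T f (Y k) \<epsilon> s N"
  fix e :: real assume fin: "(\<Sum>k. ?p k) < top" and e: "0 < e"
  \<comment> \<open>Strictness requires \<open>?p k\<close> to be finite, which follows from the
    finiteness of the whole series.\<close>
  have gap: "?p k < ?p k + ennreal (e * (1 / 2) ^ Suc k)" for k
  proof -
    have "?p k \<le> (\<Sum>k. ?p k)"
      using sum_le_suminf[of ?p "{k}"] by simp
    with fin have "?p k < top" by simp
    then show ?thesis
      using e ennreal_add_left_cancel_less[of "?p k" 0] by (simp add: top.not_eq_extremum)
  qed
  define good where "good k I n x \<longleftrightarrow> (\<forall>i\<in>I. N \<le> n i) \<and>
      Y k \<subseteq> (\<Union>i\<in>I. bowen_ball T (n i) (x i) \<epsilon>) \<and>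
      weighted_sum T f s \<epsilon> I n x < ?p k + ennreal (e * (1 / 2) ^ Suc k)" for k I n x
  have "\<exists>I n x. good k I n x" for k
    unfolding good_def by (rule bowen_pre_less[OF gap])
  then obtain I n x where "good k (I k) (n k) (x k)" for k
    by metis
  then have I: "\<And>k i. i \<in> I k \<Longrightarrow> N \<le> n k i"
      "\<And>k. Y k \<subseteq> (\<Union>i\<in>I k. bowen_ball T (n k i) (x k i) \<epsilon>)"
      "\<And>k. weighted_sum T f s \<epsilon> (I k) (n k) (x k) < ?p k + ennreal (e * (1 / 2) ^ Suc k)"
    unfolding good_def by blast+
  \<comment> \<open>The pairing function turns the covers for all \<open>k\<close> into one family
    indexed by a set of naturals.\<close>
  let ?J = "{p. snd (prod_decode p) \<in> I (fst (prod_decode p))}"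
  let ?n = "\<lambda>p. case prod_decode p of (k, i) \<Rightarrow> n k i"
  let ?x = "\<lambda>p. case prod_decode p of (k, i) \<Rightarrow> x k i"
  let ?w = "\<lambda>k i. ennreal (exp (- real (n k i) * s
      + ln (1 / \<epsilon>) * birkhoff_sum T f (n k i) (x k i)))"
  have "Z \<subseteq> (\<Union>p\<in>?J. bowen_ball T (?n p) (?x p) \<epsilon>)"
  proof
    fix z assume "z \<in> Z"
    then obtain k i where "i \<in> I k" "z \<in> bowen_ball T (n k i) (x k i) \<epsilon>"
      using assms I(2) by blast
    then show "z \<in> (\<Union>p\<in>?J. bowen_ball T (?n p) (?x p) \<epsilon>)"
      by (intro UN_I[of "prod_encode (k, i)"]) auto
  qed
  then have "bowen_pre T f Z \<epsilon> s N \<le> weighted_sum T f s \<epsilon> ?J ?n ?x"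
    by (intro bowen_pre_le_weighted_sum) (auto split: prod.split simp: I(1))
  also have "\<dots> \<le> (\<Sum>k. ?p k + ennreal (e * (1 / 2) ^ Suc k))"
    unfolding weighted_sum_def
  proof (rule infsum_le_ennreal)
    fix F assume F: "finite F" "F \<subseteq> ?J"
    \<comment> \<open>A finite \<open>F\<close> meets finitely many covers, each in finitely many
      indices, so its sum is a finite double sum that can be bounded cover by cover.\<close>
    define K where "K = (fst \<circ> prod_decode) ` F"
    define G where "G k = {i. prod_encode (k, i) \<in> F}" for k
    have fin: "finite (G k)" for k
    proof -
      have "G k \<subseteq> (snd \<circ> prod_decode) ` F"
        by (force simp: G_def)
      then show ?thesis using F(1) finite_surj by blast
    qed
    have dec: "prod_decode p \<in> Sigma K G" if "p \<in> F" for p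
    proof -
      obtain k i where "prod_decode p = (k, i)" by force
      moreover from this have "p = prod_encode (k, i)"
        by (metis prod_decode_inverse)
      ultimately show ?thesis
        using that by (force simp: K_def G_def)
    qed
    have "(\<Sum>p\<in>F. ennreal (exp (- real (?n p) * s + ln (1 / \<epsilon>) * birkhoff_sum T f (?n p) (?x p))))
        = (\<Sum>(k, i)\<in>Sigma K G. ?w k i)"
      by (rule sum.reindex_bij_witness[of _ prod_encode prod_decode])
        (use dec in \<open>auto simp: G_def split: prod.splits\<close>)
    also have "\<dots> = (\<Sum>k\<in>K. \<Sum>i\<in>G k. ?w k i)"
      using F(1) fin by (subst sum.Sigma) (auto simp: K_def)
    also have "\<dots> \<le> (\<Sum>k\<in>K. weighted_sum T f s \<epsilon> (I k) (n k) (x k))"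
      unfolding weighted_sum_def using F(2) fin
      by (intro sum_mono sum_le_infsum_ennreal) (auto simp: G_def)
    also have "\<dots> \<le> (\<Sum>k\<in>K. ?p k + ennreal (e * (1 / 2) ^ Suc k))"
      using I(3) by (intro sum_mono) (auto intro: less_imp_le)
    also have "\<dots> \<le> (\<Sum>k. ?p k + ennreal (e * (1 / 2) ^ Suc k))"
      using F(1) by (intro sum_le_suminf) (auto simp: K_def)
    finally show "(\<Sum>p\<in>F. ennreal (exp (- real (?n p) * s
      + ln (1 / \<epsilon>) * birkhoff_sum T f (?n p) (?x p)))) \<le> \<dots>" .
  qed
  also have "\<dots> = (\<Sum>k. ?p k) + (\<Sum>k. ennreal (e * (1 / 2) ^ Suc k))"
    by (rule suminf_add[symmetric]) auto
  also have "(\<Sum>k. ennreal (e * (1 / 2) ^ Suc k)) = ennreal e"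
    using e sums_mult[OF power_half_series, of e]
    by (intro suminf_ennreal_eq) auto
  finally show "bowen_pre T f Z \<epsilon> s N \<le> (\<Sum>k. ?p k) + ennreal e" .
qed

text \<open>Each \<open>bowen_pre\<close> on the right is at most its own limit, so no exchange of
  limit and series is required.\<close>

lemma bowen_outer_subadditive:
  assumes "Z \<subseteq> (\<Union>k::nat. Y k)"
  shows "bowen_outer T f Z \<epsilon> s \<le> (\<Sum>k. bowen_outer T f (Y k) \<epsilon> s)"
proof (rule LIMSEQ_le_const2[OF LIMSEQ_bowen_pre(1)], intro exI allI impI)
  fix N
  have "bowen_pre T f Z \<epsilon> s N \<le> (\<Sum>k. bowen_pre T f (Y k) \<epsilon> s N)"
    by (rule bowen_pre_subadditive[OF assms])
  also have "\<dots> \<le> (\<Sum>k. bowen_outer T f (Y k) \<epsilon> s)"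
    by (intro suminf_le LIMSEQ_bowen_pre(2)) auto
  finally show "bowen_pre T f Z \<epsilon> s N \<le> (\<Sum>k. bowen_outer T f (Y k) \<epsilon> s)" .
qed

text \<open>Lengths are non-negative, so no weight grows with \<open>s\<close>. Once the outer
  measure vanishes at some exponent, it vanishes at all larger ones.\<close>

lemma bowen_outer_antimono:
  assumes "s \<le> t"
  shows "bowen_outer T f Z \<epsilon> t \<le> bowen_outer T f Z \<epsilon> s"
proof (rule LIMSEQ_le[OF LIMSEQ_bowen_pre(1) LIMSEQ_bowen_pre(1)], intro exI allI impI)
  fix N
  show "bowen_pre T f Z \<epsilon> t N \<le> bowen_pre T f Z \<epsilon> s N"
    unfolding bowen_pre_def[of T f Z \<epsilon> s]
  proof (rule Inf_greatest, clarify)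
    fix I :: "nat set" and n x assume *: "\<forall>i\<in>I. N \<le> n i" "Z \<subseteq> (\<Union>i\<in>I. bowen_ball T (n i) (x i) \<epsilon>)"
    then have "bowen_pre T f Z \<epsilon> t N \<le> weighted_sum T f t \<epsilon> I n x"
      by (intro bowen_pre_le_weighted_sum) auto
    also have "\<dots> \<le> weighted_sum T f s \<epsilon> I n x"
      unfolding weighted_sum_def using assms
      by (intro infsum_mono nonneg_summable_on_complete)
        (auto intro!: ennreal_leI mult_left_mono)
    finally show "bowen_pre T f Z \<epsilon> t N \<le> weighted_sum T f s \<epsilon> I n x" .
  qed
qed

subsection \<open>Packing pressure between Bowen and spanning pressure\<close>

text \<open>Sort a packing by the lengths of its balls. The balls of one length \<open>n\<close>
  have centres that inject into every spanning set, so together they weigh at most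
  \<open>q ^ n\<close>; the lengths from \<open>N\<close> on then contribute a geometric tail, which
  tends to 0.\<close>

lemma packing_pressure_le_span_pressure:
  fixes T :: "'a::metric_space \<Rightarrow> 'a"
  assumes \<epsilon>: "0 < \<epsilon>" "\<epsilon> < 1" and "\<eta> > 0"
    and osc: "\<And>x y. dist x y \<le> \<epsilon> \<Longrightarrow> f x \<le> f y + \<eta>"
  shows "packing_pressure T f Z \<epsilon> \<le> span_pressure T f Z \<epsilon> + ereal (2 * \<eta> * ln (1 / \<epsilon>))"
proof (rule le_add_ereal_dense)
  fix b assume b: "span_pressure T f Z \<epsilon> < ereal b"
  define L where "L = ln (1 / \<epsilon>)"
  \<comment> \<open>\<open>s\<close> exceeds the rate \<open>b\<close> by
    \<open>2 * \<delta>\<close>: one \<open>\<delta>\<close> absorbs the oscillation of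
    \<open>f\<close> along an orbit, the other leaves the ratio \<open>q < 1\<close>.\<close>
  define \<delta> where "\<delta> = \<eta> * L"
  define s where "s = b + 2 * \<delta>"
  define q where "q = exp (- \<delta>)"
  have L: "L > 0" using \<epsilon> by (simp add: L_def)
  then have q: "0 < q" "q < 1" using \<open>\<eta> > 0\<close> by (auto simp: q_def \<delta>_def)
  have "eventually (\<lambda>n. ln_ennreal (span_sum T f Z \<epsilon> n) / ereal (real n) < ereal b) sequentially"
    using b unfolding span_pressure_def by (rule Limsup_lessD)
  then obtain M where M: "\<And>n. n \<ge> M \<Longrightarrow> ln_ennreal (span_sum T f Z \<epsilon> n) / ereal (real n) < ereal b"
    by (auto simp: eventually_sequentially)
  \<comment> \<open>\<open>Suc M\<close> instead of \<open>M\<close> ensures \<open>n > 0\<close>,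
    so that the division by \<open>n\<close> can be undone and \<open>bowen_dist\<close> is a true
    maximum.\<close>
  have span: "span_sum T f Z \<epsilon> n \<le> ennreal (exp (n * b))" if "n \<ge> Suc M" for n
  proof -
    have "ln_ennreal (span_sum T f Z \<epsilon> n) / ereal (real n) < ereal b"
      using M that by simp
    then have "ln_ennreal (span_sum T f Z \<epsilon> n) < ereal (n * b)"
      using that by (subst (asm) ereal_divide_less_pos) auto
    then show ?thesis by (simp add: ln_ennreal_le_iff[symmetric])
  qed
  have level: "(\<Sum>i\<in>F. ennreal (exp (- real n * s + L * birkhoff_sum T f n (x i)))) \<le> ennreal (q ^ n)"
    if "n \<ge> Suc M" "finite F" "\<And>i. i \<in> F \<Longrightarrow> x i \<in> Z"
      and disj: "disjoint_family_on (\<lambda>i. bowen_cball T n (x i) \<epsilon>) F"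
    for n and F :: "nat set" and x
  proof -
    \<comment> \<open>Multiplying by \<open>c\<close> cancels the factor
      \<open>exp (- n * s)\<close> and subtracts the oscillation \<open>n * \<delta>\<close> in the
      exponent.\<close>
    define c where "c = exp (n * s - n * \<delta>)"
    have "ennreal (c * (\<Sum>i\<in>F. exp (- real n * s + L * birkhoff_sum T f n (x i)))) \<le> span_sum T f Z \<epsilon> n"
      unfolding span_sum_def
    proof (rule INF_greatest, clarify)
      fix E assume "spanning T n \<epsilon> Z E"
      then have "\<forall>i\<in>F. \<exists>y\<in>E. bowen_dist T n (x i) y < \<epsilon>"
        using that(3) by (auto simp: spanning_def)
      then obtain y where y: "\<And>i. i \<in> F \<Longrightarrow> y i \<in> E" "\<And>i. i \<in> F \<Longrightarrow> bowen_dist T n (x i) (y i) < \<epsilon>"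
        by metis
      \<comment> \<open>A common spanning point for two centres would lie in both of their disjoint
        balls.\<close>
      have inj: "inj_on y F"
      proof (rule inj_onI, rule ccontr)
        fix i j assume ij: "i \<in> F" "j \<in> F" "y i = y j" "i \<noteq> j"
        then have "y i \<in> bowen_cball T n (x i) \<epsilon>" "y i \<in> bowen_cball T n (x j) \<epsilon>"
          using y(2)[of i] y(2)[of j] by (auto simp: bowen_cball_def)
        with disj ij show False by (auto simp: disjoint_family_on_def)
      qed
      have "c * (\<Sum>i\<in>F. exp (- real n * s + L * birkhoff_sum T f n (x i)))
          \<le> (\<Sum>i\<in>F. exp (L * birkhoff_sum T f n (y i)))"
        unfolding sum_distrib_left
      proof (rule sum_mono)
        fix i assume "i \<in> F"
        then have "birkhoff_sum T f n (x i) \<le> birkhoff_sum T f n (y i) + n * \<eta>"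
          using y(2) that(1) by (intro birkhoff_sum_le_add osc) (auto simp: bowen_dist_less_iff less_imp_le)
        then have "L * birkhoff_sum T f n (x i) \<le> L * birkhoff_sum T f n (y i) + n * \<delta>"
          using L by (auto simp: \<delta>_def algebra_simps dest: mult_left_mono[of _ _ L])
        then show "c * exp (- real n * s + L * birkhoff_sum T f n (x i))
            \<le> exp (L * birkhoff_sum T f n (y i))"
          by (simp add: c_def flip: exp_add)
      qed
      also have "\<dots> = (\<Sum>z\<in>y ` F. exp (L * birkhoff_sum T f n z))"
        using inj by (simp add: sum.reindex)
      finally have "ennreal (c * (\<Sum>i\<in>F. exp (- real n * s + L * birkhoff_sum T f n (x i))))
          \<le> (\<Sum>z\<in>y ` F. ennreal (exp (L * birkhoff_sum T f n z)))"
        by (simp add: ennreal_leI sum_ennreal)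
      also have "\<dots> = (\<Sum>z\<in>y ` F. ennreal ((1 / \<epsilon>) powr birkhoff_sum T f n z))"
        using \<epsilon> by (simp add: powr_def L_def mult.commute)
      also have "\<dots> \<le> (\<Sum>\<^sub>\<infinity>z\<in>E. ennreal ((1 / \<epsilon>) powr birkhoff_sum T f n z))"
        using that(2) y(1) by (intro sum_le_infsum_ennreal) auto
      finally show "ennreal (c * (\<Sum>i\<in>F. exp (- real n * s + L * birkhoff_sum T f n (x i)))) \<le> \<dots>" .
    qed
    also have "\<dots> \<le> ennreal (exp (n * b))" by (rule span[OF that(1)])
    finally have "c * (\<Sum>i\<in>F. exp (- real n * s + L * birkhoff_sum T f n (x i))) \<le> exp (n * b)"
      by simp
    then have "(\<Sum>i\<in>F. exp (- real n * s + L * birkhoff_sum T f n (x i))) \<le> exp (n * b) / c"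
      by (simp add: c_def field_simps)
    also have "exp (n * b) / c = q ^ n"
      by (simp add: c_def s_def q_def flip: exp_diff exp_of_nat_mult) (simp add: algebra_simps)
    finally show ?thesis by (simp add: sum_ennreal ennreal_leI)
  qed
  have pre: "packing_pre T f Z \<epsilon> s N \<le> ennreal (q ^ N / (1 - q))" if N: "N \<ge> Suc M" for N
    unfolding packing_pre_def weighted_sum_def L_def[symmetric]
  proof (rule Sup_least, clarify, rule infsum_le_ennreal)
    fix I F :: "nat set" and n x
    assume *: "\<forall>i\<in>I. N \<le> n i \<and> x i \<in> Z" "disjoint_family_on (\<lambda>i. bowen_cball T (n i) (x i) \<epsilon>) I"
      "finite F" "F \<subseteq> I"
    let ?h = "\<lambda>i. ennreal (exp (- real (n i) * s + L * birkhoff_sum T f (n i) (x i)))"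
    have "sum ?h F = (\<Sum>m\<in>n ` F. \<Sum>i\<in>{i \<in> F. n i = m}. ?h i)"
      using *(3) by (rule sum.image_gen)
    also have "\<dots> = (\<Sum>m\<in>n ` F. \<Sum>i\<in>{i \<in> F. n i = m}.
        ennreal (exp (- real m * s + L * birkhoff_sum T f m (x i))))"
      by (intro sum.cong) auto
    also have "\<dots> \<le> (\<Sum>m\<in>n ` F. ennreal (q ^ m))"
    proof (rule sum_mono, rule level)
      fix m assume m: "m \<in> n ` F"
      then show "Suc M \<le> m" using * N by fastforce
      show "disjoint_family_on (\<lambda>i. bowen_cball T m (x i) \<epsilon>) {i \<in> F. n i = m}"
        unfolding disjoint_family_on_def
      proof (intro ballI impI)
        fix i j assume "i \<in> {i \<in> F. n i = m}" "j \<in> {i \<in> F. n i = m}" "i \<noteq> j"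
        then show "bowen_cball T m (x i) \<epsilon> \<inter> bowen_cball T m (x j) \<epsilon> = {}"
          using *(2) \<open>F \<subseteq> I\<close> unfolding disjoint_family_on_def
          by (metis (mono_tags, lifting) mem_Collect_eq subsetD)
      qed
    qed (use * in auto)
    also have "\<dots> = ennreal (\<Sum>m\<in>n ` F. q ^ m)"
      using q by (intro sum_ennreal) auto
    also have "\<dots> \<le> ennreal (q ^ N / (1 - q))"
    proof (rule ennreal_leI)
      \<comment> \<open>Inserting \<open>N\<close> gives \<open>N \<le> K\<close> even for empty
        \<open>F\<close>, so that the closed form of the geometric sum applies.\<close>
      define K where "K = Max (insert N (n ` F))"
      have "n ` F \<subseteq> {N..K}" using * by (auto simp: K_def)
      then have "(\<Sum>m\<in>n ` F. q ^ m) \<le> (\<Sum>m\<in>{N..K}. q ^ m)"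
        using q by (intro sum_mono2) auto
      also have "\<dots> = (q ^ N - q ^ Suc K) / (1 - q)"
        using q *(3) by (subst sum_gp) (auto simp: K_def not_less)
      also have "\<dots> \<le> q ^ N / (1 - q)"
        using q by (intro divide_right_mono) auto
      finally show "(\<Sum>m\<in>n ` F. q ^ m) \<le> q ^ N / (1 - q)" .
    qed
    finally show "sum ?h F \<le> ennreal (q ^ N / (1 - q))" .
  qed
  have "(\<lambda>N. q ^ N / (1 - q)) \<longlonglongrightarrow> 0 / (1 - q)"
    using q by (intro tendsto_intros LIMSEQ_power_zero) auto
  then have "(\<lambda>N. ennreal (q ^ N / (1 - q))) \<longlonglongrightarrow> ennreal 0"
    by (intro tendsto_ennrealI) simp
  then have "packing_premeasure T f Z \<epsilon> s \<le> ennreal 0"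
    by (rule LIMSEQ_le[OF LIMSEQ_packing_pre]) (use pre in blast)
  then have "packing_premeasure T f Z \<epsilon> s = 0" by simp
  \<comment> \<open>The constant decomposition into copies of \<open>Z\<close> suffices, since every
    term of its series is 0.\<close>
  then have "packing_outer T f Z \<epsilon> s = 0"
    unfolding packing_outer_def by (intro antisym INF_lower2[of "\<lambda>_. Z"]) auto
  then have "packing_pressure T f Z \<epsilon> \<le> ereal s"
    unfolding packing_pressure_def by (intro INF_lower) auto
  then show "packing_pressure T f Z \<epsilon> \<le> ereal (b + 2 * \<eta> * ln (1 / \<epsilon>))"
    by (simp add: s_def \<delta>_def L_def mult.assoc)
qed

text \<open>For each \<open>N\<close>, a maximal disjoint family of closed balls of length exactly
  \<open>N\<close> is a competitor for the packing supremum, and the balls with tripled radius cover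
  \<open>Z\<close>. The shift \<open>ln 3 * F\<close> pays, per unit of time, for replacing
  \<open>ln (1 / \<epsilon>)\<close> by \<open>ln (1 / (3 * \<epsilon>))\<close>.\<close>

lemma bowen_outer_le_packing_premeasure:
  fixes T :: "'a::metric_space \<Rightarrow> 'a"
  assumes X: "compact (UNIV :: 'a set)" "continuous_on UNIV T" and \<epsilon>: "0 < \<epsilon>"
    and F: "\<And>x. \<bar>f x\<bar> \<le> F"
  shows "bowen_outer T f Z (3 * \<epsilon>) (s + ln 3 * F) \<le> packing_premeasure T f Z \<epsilon> s"
proof (rule LIMSEQ_le[OF LIMSEQ_bowen_pre(1) LIMSEQ_packing_pre], intro exI allI impI)
  fix N :: nat assume N: "1 \<le> N"
  define packed where "packed A \<longleftrightarrow> A \<subseteq> Z \<and> disjoint_family_on (\<lambda>x. bowen_cball T N x \<epsilon>) A" for A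
  obtain E where E: "finite E" "spanning T N \<epsilon> UNIV E"
    using finite_spanning_exists[OF X _ \<epsilon>, of N] N by auto
  \<comment> \<open>Centres of disjoint balls inject into the finite spanning set \<open>E\<close>;
    this bounds their number, so a packing of greatest cardinality exists.\<close>
  have card: "finite A \<and> card A \<le> card E" if "packed A" for A
  proof -
    obtain y where y: "\<And>x. y x \<in> E" "\<And>x. bowen_dist T N x (y x) < \<epsilon>"
      using E(2) unfolding spanning_def by (metis UNIV_I)
    have "inj_on y A"
    proof (rule inj_onI, rule ccontr)
      fix a b assume ab: "a \<in> A" "b \<in> A" "y a = y b" "a \<noteq> b"
      then have "y a \<in> bowen_cball T N a \<epsilon>" "y a \<in> bowen_cball T N b \<epsilon>"
        using y(2)[of a] y(2)[of b] by (auto simp: bowen_cball_def)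
      with that ab show False by (auto simp: packed_def disjoint_family_on_def)
    qed
    then show ?thesis
      using E(1) y(1) by (metis card_inj_on_le finite_imageD finite_subset image_subsetI)
  qed
  have "packed {}" by (simp add: packed_def disjoint_family_on_def)
  then obtain A where A: "packed A" "\<And>B. packed B \<Longrightarrow> card B \<le> card A"
    using ex_has_greatest_nat[of packed "{}" card "Suc (card E)"] card by (metis less_Suc_eq_le)
  have fin: "finite A" using A card by blast
  obtain x where x: "bij_betw x {..<card A} A"
    using ex_bij_betw_nat_finite[OF fin] by (auto simp: atLeast0LessThan)
  have "Z \<subseteq> (\<Union>i\<in>{..<card A}. bowen_ball T N (x i) (3 * \<epsilon>))"
  proof
    fix z assume z: "z \<in> Z"
    \<comment> \<open>Otherwise \<open>z\<close> could be added to the packing \<open>A\<close>,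
      contradicting its greatest cardinality.\<close>
    have "\<exists>a\<in>A. bowen_cball T N a \<epsilon> \<inter> bowen_cball T N z \<epsilon> \<noteq> {}"
    proof (rule ccontr)
      assume *: "\<not> ?thesis"
      have "z \<in> bowen_cball T N z \<epsilon>"
        using N \<epsilon> by (simp add: bowen_cball_def bowen_dist_le_iff)
      with * have "z \<notin> A" by blast
      moreover have "packed (insert z A)"
        using A(1) * z unfolding packed_def disjoint_family_on_def by blast
      ultimately show False
        using A(2)[of "insert z A"] fin by simp
    qed
    then obtain a w where aw: "a \<in> A" "w \<in> bowen_cball T N a \<epsilon>" "w \<in> bowen_cball T N z \<epsilon>"
      by blast
    have "z \<in> bowen_ball T N a (3 * \<epsilon>)"
    proof -
      have "dist ((T ^^ j) a) ((T ^^ j) z) < 3 * \<epsilon>" if "j < N" for j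
      proof -
        have "dist ((T ^^ j) a) ((T ^^ j) w) \<le> \<epsilon>" "dist ((T ^^ j) z) ((T ^^ j) w) \<le> \<epsilon>"
          using aw that by (auto simp: bowen_cball_def bowen_dist_le_iff)
        then show ?thesis
          using dist_triangle2[of "(T ^^ j) a" "(T ^^ j) z" "(T ^^ j) w"] \<epsilon> by linarith
      qed
      then show ?thesis using N by (simp add: bowen_ball_def bowen_dist_less_iff)
    qed
    moreover obtain i where "i < card A" "x i = a"
      using x aw(1) by (metis bij_betw_def imageE lessThan_iff)
    ultimately show "z \<in> (\<Union>i\<in>{..<card A}. bowen_ball T N (x i) (3 * \<epsilon>))" by blast
  qed
  then have "bowen_pre T f Z (3 * \<epsilon>) (s + ln 3 * F) N
      \<le> weighted_sum T f (s + ln 3 * F) (3 * \<epsilon>) {..<card A} (\<lambda>_. N) x"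
    by (intro bowen_pre_le_weighted_sum) auto
  also have "\<dots> \<le> weighted_sum T f s \<epsilon> {..<card A} (\<lambda>_. N) x"
    unfolding weighted_sum_def
  proof (intro infsum_mono nonneg_summable_on_complete)
    fix i
    have "ln 3 * - birkhoff_sum T f N (x i) \<le> ln 3 * (real N * F)"
      using abs_birkhoff_sum_le[of f F T N "x i"] F by (intro mult_left_mono) auto
    moreover have eq: "ln (1 / (3 * \<epsilon>)) = ln (1 / \<epsilon>) - ln 3"
      using \<epsilon> by (simp add: ln_div ln_mult)
    ultimately show "ennreal (exp (- real N * (s + ln 3 * F) + ln (1 / (3 * \<epsilon>)) * birkhoff_sum T f N (x i)))
        \<le> ennreal (exp (- real N * s + ln (1 / \<epsilon>) * birkhoff_sum T f N (x i)))"
      unfolding eq by (intro ennreal_leI) (simp add: algebra_simps)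
  qed auto
  also have "\<dots> \<le> packing_pre T f Z \<epsilon> s N"
  proof (rule weighted_sum_le_packing_pre)
    show "x i \<in> Z" if "i \<in> {..<card A}" for i
      using A(1) x that by (auto simp: packed_def bij_betw_def)
    show "disjoint_family_on (\<lambda>i. bowen_cball T N (x i) \<epsilon>) {..<card A}"
      unfolding disjoint_family_on_def
    proof (intro ballI impI)
      fix i j assume "i \<in> {..<card A}" "j \<in> {..<card A}" "i \<noteq> j"
      then have "x i \<in> A" "x j \<in> A" "x i \<noteq> x j"
        using x by (auto simp: bij_betw_def inj_on_def)
      then show "bowen_cball T N (x i) \<epsilon> \<inter> bowen_cball T N (x j) \<epsilon> = {}"
        using A(1) by (auto simp: packed_def disjoint_family_on_def)
    qed
  qed auto
  finally show "bowen_pre T f Z (3 * \<epsilon>) (s + ln 3 * F) N \<le> packing_pre T f Z \<epsilon> s N" .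
qed

text \<open>The packing outer measure is an infimum over countable decompositions: the comparison
  applies to each piece, and subadditivity of the Bowen outer measure reassembles the
  pieces.\<close>

lemma bowen_pressure_le_packing_pressure:
  fixes T :: "'a::metric_space \<Rightarrow> 'a"
  assumes "compact (UNIV :: 'a set)" "continuous_on UNIV T" "0 < \<epsilon>" "\<And>x. \<bar>f x\<bar> \<le> F"
  shows "bowen_pressure T f Z (3 * \<epsilon>) \<le> packing_pressure T f Z \<epsilon> + ereal (ln 3 * F)"
  unfolding packing_pressure_def
proof (rule le_Inf_add_ereal, clarify)
  fix s assume s: "packing_outer T f Z \<epsilon> s = 0"
  have "bowen_outer T f Z (3 * \<epsilon>) (s + ln 3 * F) \<le> packing_outer T f Z \<epsilon> s"
    unfolding packing_outer_def
  proof (rule INF_greatest, clarify)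
    fix Y :: "nat \<Rightarrow> 'a set" assume "Z \<subseteq> (\<Union>i. Y i)"
    then have "bowen_outer T f Z (3 * \<epsilon>) (s + ln 3 * F) \<le> (\<Sum>i. bowen_outer T f (Y i) (3 * \<epsilon>) (s + ln 3 * F))"
      by (rule bowen_outer_subadditive)
    also have "\<dots> \<le> (\<Sum>i. packing_premeasure T f (Y i) \<epsilon> s)"
      by (intro suminf_le bowen_outer_le_packing_premeasure assms) auto
    finally show "bowen_outer T f Z (3 * \<epsilon>) (s + ln 3 * F) \<le> (\<Sum>i. packing_premeasure T f (Y i) \<epsilon> s)" .
  qed
  then show "bowen_pressure T f Z (3 * \<epsilon>) \<le> ereal (s + ln 3 * F)"
    unfolding bowen_pressure_def using s by (intro INF_lower) auto
qed

subsection \<open>Bowen's concatenation argument\<close>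

text \<open>
  The sets of the cover are intersections \<open>B\<^sub>1 \<inter> T\<^sup>-\<^sup>a B\<^sub>2 \<inter> T\<^sup>-\<^sup>b B\<^sub>3 \<inter> \<dots>\<close> of
  preimages of the given Bowen balls, at times \<open>0 < a < b < \<dots>\<close> determined by their lengths.  A
  pair \<open>(C, w)\<close> stands for such a set with an upper bound \<open>w\<close> of \<open>exp (L * S\<^sub>N f)\<close> on it; the
  constant \<open>K\<close> pays for the last ball, which may extend beyond time \<open>N\<close>.
\<close>

lemma concatenated_cover:
  fixes T :: "'a::metric_space \<Rightarrow> 'a" and f :: "'a \<Rightarrow> real" and I :: "'i set" and L s \<eta> F :: real
  defines "\<theta> \<equiv> \<lambda>m z. exp (- real m * s + L * birkhoff_sum T f m z)"
  assumes "finite I" and pos: "\<And>i. i \<in> I \<Longrightarrow> 0 < n i"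
    and cov: "UNIV \<subseteq> (\<Union>i\<in>I. bowen_ball T (n i) (x i) \<epsilon>)"
    and le1: "(\<Sum>i\<in>I. \<theta> (n i) (x i)) \<le> 1"
    and osc: "\<And>x y. dist x y \<le> \<epsilon> \<Longrightarrow> f x \<le> f y + \<eta>"
    and bound: "\<And>x. \<bar>f x\<bar> \<le> F" and "L \<ge> 0"
  obtains K where "K > 0" and "\<And>N. \<exists>P. finite P \<and> UNIV \<subseteq> \<Union> (fst ` P) \<and>
      (\<Sum>p\<in>P. snd p) \<le> K * exp (real N * (s + L * \<eta>)) \<and>
      (\<forall>p\<in>P. 0 \<le> snd p \<and> (\<forall>z\<in>fst p. exp (L * birkhoff_sum T f N z) \<le> snd p) \<and>
        (\<forall>y\<in>fst p. \<forall>z\<in>fst p. \<forall>j<N. dist ((T ^^ j) y) ((T ^^ j) z) < 2 * \<epsilon>))"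
proof -
  define v where "v = s + L * \<eta>"
  \<comment> \<open>If ball \<open>i\<close> outlasts the remaining time \<open>N\<close>, its
    weight is bounded crudely by \<open>exp (L * (real N * F))\<close>. \<open>r i N\<close> is the
    constant this demands, and \<open>K\<close> dominates the finitely many demands; the summand 1
    serves \<open>N = 0\<close>.\<close>
  define r where "r i N = exp (L * (real N * F)) / (\<theta> (n i) (x i) * exp (real N * v))" for i N
  define K where "K = 1 + (\<Sum>i\<in>I. \<Sum>N<n i. r i N)"
  have \<theta>: "\<theta> m z > 0" for m z by (simp add: \<theta>_def)
  have r: "r i N \<ge> 0" for i N using \<theta>[of "n i" "x i"] by (simp add: r_def)
  have K1: "K \<ge> 1" unfolding K_def using r by (simp add: sum_nonneg)
  have Kr: "exp (L * (real N * F)) \<le> \<theta> (n i) (x i) * (K * exp (real N * v))"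
    if "i \<in> I" "N < n i" for i N
  proof -
    have "r i N \<le> (\<Sum>N<n i. r i N)"
      using r that by (intro member_le_sum) auto
    also have "\<dots> \<le> (\<Sum>i\<in>I. \<Sum>N<n i. r i N)"
      using r that \<open>finite I\<close> by (intro member_le_sum[of i I "\<lambda>i. \<Sum>N<n i. r i N"]) (auto intro: sum_nonneg)
    finally have "r i N \<le> K" by (simp add: K_def)
    then show ?thesis
      using \<theta>[of "n i" "x i"] by (simp add: r_def pos_divide_le_eq mult_ac)
  qed
  define good where "good N P \<longleftrightarrow> finite P \<and> UNIV \<subseteq> \<Union> (fst ` P) \<and>
      (\<Sum>p\<in>P. snd p) \<le> K * exp (real N * v) \<and>
      (\<forall>p\<in>P. 0 \<le> snd p \<and> (\<forall>z\<in>fst p. exp (L * birkhoff_sum T f N z) \<le> snd p) \<and>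
        (\<forall>y\<in>fst p. \<forall>z\<in>fst p. \<forall>j<N. dist ((T ^^ j) y) ((T ^^ j) z) < 2 * \<epsilon>))"
    for N and P :: "('a set \<times> real) set"
  have ball_dist: "dist ((T ^^ j) y) ((T ^^ j) z) < 2 * \<epsilon>"
    if "i \<in> I" "y \<in> bowen_ball T (n i) (x i) \<epsilon>" "z \<in> bowen_ball T (n i) (x i) \<epsilon>" "j < n i" for i j y z
  proof -
    have "dist ((T ^^ j) (x i)) ((T ^^ j) y) < \<epsilon>" "dist ((T ^^ j) (x i)) ((T ^^ j) z) < \<epsilon>"
      using that pos by (auto simp: bowen_ball_def bowen_dist_less_iff)
    then show ?thesis
      using dist_triangle3[of "(T ^^ j) y" "(T ^^ j) z" "(T ^^ j) (x i)"] by linarith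
  qed
  have "\<exists>P. good N P" for N
  proof (induction N rule: less_induct)
    case (less N)
    show ?case
    proof (cases "N = 0")
      case True
      then have "good N {(UNIV, 1)}"
        using K1 by (simp add: good_def birkhoff_sum_def)
      then show ?thesis by blast
    next
      case False
      \<comment> \<open>After a first ball of positive length \<open>n i\<close>, strictly less time
        remains, and the induction hypothesis supplies a cover for it.\<close>
      have "\<forall>i\<in>I. \<exists>Q. n i \<le> N \<longrightarrow> good (N - n i) Q"
        using less False pos by (metis diff_less neq0_conv)
      then obtain Q where Q: "\<And>i. i \<in> I \<Longrightarrow> n i \<le> N \<Longrightarrow> good (N - n i) (Q i)"
        by metis
      \<comment> \<open>The factor \<open>exp (real (n i) * v)\<close> cancels
        \<open>- n i * s\<close> in \<open>\<theta>\<close> and adds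
        \<open>n i * L * \<eta>\<close>, which turns the weight at the centre into an upper bound on
        the whole ball.\<close>
      define g where "g i p = (bowen_ball T (n i) (x i) \<epsilon> \<inter> (T ^^ n i) -` fst p,
          \<theta> (n i) (x i) * exp (real (n i) * v) * snd p)" for i and p :: "'a set \<times> real"
      define R where "R i = (if n i \<le> N then g i ` Q i
          else {(bowen_ball T (n i) (x i) \<epsilon>, exp (L * (real N * F)))})" for i
      have fin: "finite (R i)" if "i \<in> I" for i
        using Q that by (auto simp: R_def good_def)
      have nonneg: "0 \<le> snd p" if "i \<in> I" "p \<in> R i" for i p
        using Q[of i] that \<theta>[of "n i" "x i"]
        by (force simp: R_def g_def good_def split: if_splits)
      have cover: "\<exists>p\<in>R i. y \<in> fst p" if "i \<in> I" "y \<in> bowen_ball T (n i) (x i) \<epsilon>" for i y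
      proof (cases "n i \<le> N")
        case True
        with Q[of i] that obtain q where "q \<in> Q i" "(T ^^ n i) y \<in> fst q"
          unfolding good_def by blast
        with True that show ?thesis
          by (auto simp: R_def g_def intro!: bexI[of _ q])
      qed (use that in \<open>auto simp: R_def\<close>)
      have weight: "exp (L * birkhoff_sum T f N z) \<le> snd p"
        if i: "i \<in> I" and p: "p \<in> R i" and z: "z \<in> fst p" for i p z
      proof (cases "n i \<le> N")
        case True
        with p obtain q where q: "q \<in> Q i" "p = g i q" by (auto simp: R_def)
        let ?z = "(T ^^ n i) z"
        have zb: "z \<in> bowen_ball T (n i) (x i) \<epsilon>" "?z \<in> fst q"
          using z q by (auto simp: g_def)
        have "birkhoff_sum T f (n i) z \<le> birkhoff_sum T f (n i) (x i) + real (n i) * \<eta>"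
          using zb(1) pos[OF i]
          by (intro birkhoff_sum_le_add osc)
            (auto simp: bowen_ball_def bowen_dist_less_iff dist_commute less_imp_le)
        then have "L * birkhoff_sum T f (n i) z
            \<le> L * (birkhoff_sum T f (n i) (x i) + real (n i) * \<eta>)"
          using \<open>L \<ge> 0\<close> by (rule mult_left_mono)
        then have "exp (L * birkhoff_sum T f (n i) z) \<le> \<theta> (n i) (x i) * exp (real (n i) * v)"
          by (simp add: \<theta>_def v_def algebra_simps flip: exp_add)
        moreover have "exp (L * birkhoff_sum T f (N - n i) ?z) \<le> snd q"
          using Q[OF i True] q(1) zb(2) unfolding good_def by blast
        ultimately have "exp (L * birkhoff_sum T f (n i) z) * exp (L * birkhoff_sum T f (N - n i) ?z)
            \<le> snd p"
          unfolding q(2) g_def snd_conv using \<theta>[of "n i" "x i"] by (intro mult_mono) auto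
        then show ?thesis
          using birkhoff_sum_add[of T f "n i" "N - n i" z] True
          by (simp add: distrib_left flip: exp_add)
      next
        case False
        have "birkhoff_sum T f N z \<le> real N * F"
          using abs_birkhoff_sum_le[of f F T N z] bound by auto
        then show ?thesis
          using p False \<open>L \<ge> 0\<close> by (auto simp: R_def intro: mult_left_mono)
      qed
      have small: "dist ((T ^^ j) y) ((T ^^ j) z) < 2 * \<epsilon>"
        if i: "i \<in> I" and p: "p \<in> R i" and yz: "y \<in> fst p" "z \<in> fst p" and "j < N" for i p y z j
      proof (cases "j < n i")
        case True
        with i yz p show ?thesis
          by (intro ball_dist) (auto simp: R_def g_def split: if_splits)
      next
        case False
        with p \<open>j < N\<close> obtain q where q: "q \<in> Q i" "p = g i q" by (auto simp: R_def)
        have "dist ((T ^^ (j - n i)) ((T ^^ n i) y)) ((T ^^ (j - n i)) ((T ^^ n i) z)) < 2 * \<epsilon>"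
          using Q[OF i] q yz False \<open>j < N\<close> by (auto simp: good_def g_def)
        moreover have "(T ^^ (j - n i)) ((T ^^ n i) w) = (T ^^ j) w" for w
          using False by (metis comp_apply funpow_add le_add_diff_inverse2 not_less)
        ultimately show ?thesis by simp
      qed
      have mass: "(\<Sum>p\<in>R i. snd p) \<le> \<theta> (n i) (x i) * (K * exp (real N * v))" if i: "i \<in> I" for i
      proof (cases "n i \<le> N")
        case True
        have Qi: "good (N - n i) (Q i)" using Q i True by blast
        \<comment> \<open>Only an inequality, as different members of \<open>Q i\<close> may have
          the same image under \<open>g i\<close>.\<close>
        have "(\<Sum>p\<in>R i. snd p) \<le> (\<Sum>q\<in>Q i. snd (g i q))"
          using Qi True nonneg[OF i] unfolding R_def
          by (simp, intro sum_image_le[unfolded o_def]) (auto simp: good_def)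
        also have "\<dots> = \<theta> (n i) (x i) * exp (real (n i) * v) * (\<Sum>q\<in>Q i. snd q)"
          by (simp add: g_def sum_distrib_left)
        also have "\<dots> \<le> \<theta> (n i) (x i) * exp (real (n i) * v) * (K * exp (real (N - n i) * v))"
          using Qi \<theta>[of "n i" "x i"] by (intro mult_left_mono) (auto simp: good_def)
        also have "\<dots> = \<theta> (n i) (x i) * (K * exp (real (n i) * v + real (N - n i) * v))"
          by (simp add: exp_add)
        also have "real (n i) * v + real (N - n i) * v = real N * v"
          using True by (simp add: of_nat_diff algebra_simps)
        finally show ?thesis .
      next
        case False
        then show ?thesis using Kr[OF i] by (simp add: R_def)
      qed
      have "(\<Sum>p\<in>(\<Union>i\<in>I. R i). snd p) \<le> (\<Sum>i\<in>I. \<Sum>p\<in>R i. snd p)"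
      proof -
        have "(\<Union>i\<in>I. R i) = snd ` Sigma I R" by force
        then have "(\<Sum>p\<in>(\<Union>i\<in>I. R i). snd p) \<le> (\<Sum>q\<in>Sigma I R. snd (snd q))"
          using \<open>finite I\<close> fin nonneg by (simp only:, intro sum_image_le[unfolded o_def]) auto
        also have "\<dots> = (\<Sum>i\<in>I. \<Sum>p\<in>R i. snd p)"
          using \<open>finite I\<close> fin by (subst sum.Sigma) (auto simp: case_prod_unfold)
        finally show ?thesis .
      qed
      also have "\<dots> \<le> (\<Sum>i\<in>I. \<theta> (n i) (x i) * (K * exp (real N * v)))"
        by (intro sum_mono mass)
      also have "\<dots> = (\<Sum>i\<in>I. \<theta> (n i) (x i)) * (K * exp (real N * v))"
        by (simp add: sum_distrib_right)
      \<comment> \<open>Here the total weight of at most 1 closes the induction: the same constant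
        \<open>K\<close> is recovered, whatever the number of concatenations.\<close>
      also have "\<dots> \<le> K * exp (real N * v)"
        using le1 K1 by (intro mult_left_le_one_le sum_nonneg less_imp_le[OF \<theta>]) auto
      finally have "(\<Sum>p\<in>(\<Union>i\<in>I. R i). snd p) \<le> K * exp (real N * v)" .
      moreover have "UNIV \<subseteq> \<Union> (fst ` (\<Union>i\<in>I. R i))"
        using cov cover by blast
      ultimately have "good N (\<Union>i\<in>I. R i)"
        unfolding good_def using \<open>finite I\<close> fin nonneg weight small by blast
      then show ?thesis by blast
    qed
  qed
  then show ?thesis
    using that[of K] K1 unfolding good_def v_def by force
qed

text \<open>A vanishing outer measure gives a cover of weight below 1, and compactness a finite one.
  Choosing a point in each set of the concatenated cover yields spanning sets; the constant
  \<open>K\<close> is lost in the rate, and \<open>ln 2 * F\<close> pays for the doubled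
  radius.\<close>

lemma span_pressure_le_bowen_pressure:
  fixes T :: "'a::metric_space \<Rightarrow> 'a"
  assumes X: "compact (UNIV :: 'a set)" "continuous_on UNIV T" and \<epsilon>: "0 < \<epsilon>" "\<epsilon> < 1"
    and osc: "\<And>x y. dist x y \<le> \<epsilon> \<Longrightarrow> f x \<le> f y + \<eta>"
    and bound: "\<And>x. \<bar>f x\<bar> \<le> F"
  shows "span_pressure T f UNIV (2 * \<epsilon>)
    \<le> bowen_pressure T f UNIV \<epsilon> + ereal (\<eta> * ln (1 / \<epsilon>) + ln 2 * F)"
  unfolding bowen_pressure_def
proof (rule le_Inf_add_ereal, clarify)
  fix s assume s: "bowen_outer T f UNIV \<epsilon> s = 0"
  define L where "L = ln (1 / \<epsilon>)"
  have L: "L \<ge> 0" using \<epsilon> by (simp add: L_def)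
  define h where "h = s + L * \<eta> + ln 2 * F"
  \<comment> \<open>Starting at 1 rules out balls of length 0, for which \<open>bowen_dist\<close>
    is unspecified and concatenation would not advance.\<close>
  have "bowen_pre T f UNIV \<epsilon> s 1 < 1"
    using LIMSEQ_bowen_pre(2)[of T f UNIV \<epsilon> s 1] s by simp
  from bowen_pre_less[OF this] obtain I n x where I: "\<And>i. i \<in> I \<Longrightarrow> 1 \<le> n i"
      "UNIV \<subseteq> (\<Union>i\<in>I. bowen_ball T (n i) (x i) \<epsilon>)" "weighted_sum T f s \<epsilon> I n x < 1"
    by blast
  have "\<And>i. i \<in> I \<Longrightarrow> open (bowen_ball T (n i) (x i) \<epsilon>)"
    using open_bowen_ball[OF X(2)] I(1) by (metis One_nat_def Suc_le_eq)
  then obtain J where J: "J \<subseteq> I" "finite J" "UNIV \<subseteq> (\<Union>i\<in>J. bowen_ball T (n i) (x i) \<epsilon>)"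
    using compactE_image[OF X(1) _ I(2)] by metis
  have "ennreal (\<Sum>i\<in>J. exp (- real (n i) * s + L * birkhoff_sum T f (n i) (x i)))
      = (\<Sum>i\<in>J. ennreal (exp (- real (n i) * s + L * birkhoff_sum T f (n i) (x i))))"
    by (simp add: sum_ennreal)
  also have "\<dots> \<le> weighted_sum T f s \<epsilon> I n x"
    unfolding weighted_sum_def L_def using J by (intro sum_le_infsum_ennreal)
  also have "\<dots> \<le> 1" using I(3) by simp
  finally have le1: "(\<Sum>i\<in>J. exp (- real (n i) * s + L * birkhoff_sum T f (n i) (x i))) \<le> 1"
    by (simp add: ennreal_le_1)
  obtain K where K: "K > 0" "\<And>N. \<exists>P. finite P \<and> UNIV \<subseteq> \<Union> (fst ` P) \<and>
      (\<Sum>p\<in>P. snd p) \<le> K * exp (real N * (s + L * \<eta>)) \<and>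
      (\<forall>p\<in>P. 0 \<le> snd p \<and> (\<forall>z\<in>fst p. exp (L * birkhoff_sum T f N z) \<le> snd p) \<and>
        (\<forall>y\<in>fst p. \<forall>z\<in>fst p. \<forall>j<N. dist ((T ^^ j) y) ((T ^^ j) z) < 2 * \<epsilon>))"
    by (rule concatenated_cover[OF J(2) _ J(3) le1 osc bound L])
      (use I(1) J(1) in \<open>auto simp: Suc_le_eq\<close>)
  have span: "span_sum T f UNIV (2 * \<epsilon>) N \<le> ennreal (exp (ln K + real N * h))" if N: "N > 0" for N
  proof -
    obtain P where P: "finite P" "UNIV \<subseteq> \<Union> (fst ` P)"
      "(\<Sum>p\<in>P. snd p) \<le> K * exp (real N * (s + L * \<eta>))"
      "\<And>p. p \<in> P \<Longrightarrow> 0 \<le> snd p"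
      "\<And>p z. p \<in> P \<Longrightarrow> z \<in> fst p \<Longrightarrow> exp (L * birkhoff_sum T f N z) \<le> snd p"
      "\<And>p y z j. p \<in> P \<Longrightarrow> y \<in> fst p \<Longrightarrow> z \<in> fst p \<Longrightarrow> j < N \<Longrightarrow>
         dist ((T ^^ j) y) ((T ^^ j) z) < 2 * \<epsilon>"
      using K(2)[of N] by blast
    define P' where "P' = {p \<in> P. fst p \<noteq> {}}"
    define z where "z p = (SOME z. z \<in> fst p)" for p :: "'a set \<times> real"
    have z: "z p \<in> fst p" if "p \<in> P'" for p
      using that some_in_eq unfolding P'_def z_def by blast
    have "spanning T N (2 * \<epsilon>) UNIV (z ` P')"
      unfolding spanning_def
    proof
      fix y :: 'a
      obtain p where p: "p \<in> P" "y \<in> fst p" using P(2) by blast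
      then have p': "p \<in> P'" by (auto simp: P'_def)
      have "bowen_dist T N y (z p) < 2 * \<epsilon>"
        using P(6)[OF p z[OF p']] N by (simp add: bowen_dist_less_iff)
      with p' show "\<exists>w\<in>z ` P'. bowen_dist T N y w < 2 * \<epsilon>" by blast
    qed
    then have "span_sum T f UNIV (2 * \<epsilon>) N
        \<le> (\<Sum>\<^sub>\<infinity>w\<in>z ` P'. ennreal ((1 / (2 * \<epsilon>)) powr birkhoff_sum T f N w))"
      unfolding span_sum_def by (intro INF_lower) simp
    also have "\<dots> = ennreal (\<Sum>w\<in>z ` P'. (1 / (2 * \<epsilon>)) powr birkhoff_sum T f N w)"
      using P(1) by (simp add: P'_def sum_ennreal)
    also have "\<dots> \<le> ennreal (exp (ln K + real N * h))"
    proof (rule ennreal_leI)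
      have "(\<Sum>w\<in>z ` P'. (1 / (2 * \<epsilon>)) powr birkhoff_sum T f N w)
          \<le> (\<Sum>p\<in>P'. (1 / (2 * \<epsilon>)) powr birkhoff_sum T f N (z p))"
        using P(1) by (intro sum_image_le[unfolded o_def]) (auto simp: P'_def)
      also have "\<dots> \<le> (\<Sum>p\<in>P'. exp (real N * (ln 2 * F)) * snd p)"
      proof (rule sum_mono)
        fix p assume p: "p \<in> P'"
        let ?S = "birkhoff_sum T f N (z p)"
        have "ln 2 * - ?S \<le> ln 2 * (real N * F)"
          using abs_birkhoff_sum_le[of f F T N "z p"] bound by (intro mult_left_mono) auto
        moreover have "(1 / (2 * \<epsilon>)) powr ?S = exp ((L - ln 2) * ?S)"
          using \<epsilon> by (simp add: powr_def L_def ln_div ln_mult algebra_simps)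
        ultimately have "(1 / (2 * \<epsilon>)) powr ?S \<le> exp (real N * (ln 2 * F)) * exp (L * ?S)"
          by (simp add: algebra_simps flip: exp_add)
        also have "\<dots> \<le> exp (real N * (ln 2 * F)) * snd p"
          using p z P(5) by (intro mult_left_mono) (auto simp: P'_def)
        finally show "(1 / (2 * \<epsilon>)) powr ?S \<le> \<dots>" .
      qed
      also have "\<dots> = exp (real N * (ln 2 * F)) * (\<Sum>p\<in>P'. snd p)"
        by (simp add: sum_distrib_left)
      also have "\<dots> \<le> exp (real N * (ln 2 * F)) * (\<Sum>p\<in>P. snd p)"
        using P(1,4) by (intro mult_left_mono sum_mono2) (auto simp: P'_def)
      also have "\<dots> \<le> exp (real N * (ln 2 * F)) * (K * exp (real N * (s + L * \<eta>)))"
        using P(3) by (intro mult_left_mono) auto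
      also have "\<dots> = exp (ln K + real N * h)"
        using K(1) by (simp add: h_def exp_add algebra_simps)
      finally show "(\<Sum>w\<in>z ` P'. (1 / (2 * \<epsilon>)) powr birkhoff_sum T f N w) \<le> exp (ln K + real N * h)" .
    qed
    finally show ?thesis .
  qed
  have "eventually (\<lambda>N. ln_ennreal (span_sum T f UNIV (2 * \<epsilon>) N) / ereal (real N)
      \<le> ereal (ln K / real N + h)) sequentially"
    using eventually_gt_at_top[of 0]
  proof eventually_elim
    case (elim N)
    then have "ln_ennreal (span_sum T f UNIV (2 * \<epsilon>) N) \<le> ereal (ln K + real N * h)"
      using span by (simp add: ln_ennreal_le_iff)
    with elim show ?case
      by (subst ereal_divide_le_pos) (auto simp: algebra_simps)
  qed
  then have "span_pressure T f UNIV (2 * \<epsilon>) \<le> limsup (\<lambda>N. ereal (ln K / real N + h))"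
    unfolding span_pressure_def by (rule Limsup_mono)
  also have "\<dots> = ereal h"
  proof (rule lim_imp_Limsup)
    have "(\<lambda>N. ln K / real N + h) \<longlonglongrightarrow> 0 + h"
      by (intro tendsto_intros lim_const_over_n)
    then show "(\<lambda>N. ereal (ln K / real N + h)) \<longlonglongrightarrow> ereal h" by simp
  qed simp
  finally show "span_pressure T f UNIV (2 * \<epsilon>) \<le> ereal (s + (\<eta> * ln (1 / \<epsilon>) + ln 2 * F))"
    by (simp add: h_def L_def algebra_simps)
qed

subsection \<open>Comparison of the mean dimensions\<close>

text \<open>A strict bound provides an exponent below \<open>b\<close> with vanishing outer measure,
  so all pieces vanish at the common exponent \<open>b\<close>, and so does the union.\<close>

lemma bowen_pressure_UN_le:
  assumes "countable A" "A \<noteq> {}" "Z \<subseteq> (\<Union>a\<in>A. Y a)"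
    and less: "\<And>a. a \<in> A \<Longrightarrow> bowen_pressure T f (Y a) \<epsilon> < ereal b"
  shows "bowen_pressure T f Z \<epsilon> \<le> ereal b"
proof -
  have zero: "bowen_outer T f (Y a) \<epsilon> b = 0" if a: "a \<in> A" for a
  proof -
    obtain s where "bowen_outer T f (Y a) \<epsilon> s = 0" "s < b"
      using less[OF a] by (auto simp: bowen_pressure_def Inf_less_iff)
    then show ?thesis
      using bowen_outer_antimono[of s b T f "Y a" \<epsilon>] by simp
  qed
  \<comment> \<open>A finite \<open>A\<close> is enumerated with repetitions, which is harmless as
    every term of the series is 0.\<close>
  have "Z \<subseteq> (\<Union>k. Y (from_nat_into A k))"
  proof -
    have "(\<Union>k. Y (from_nat_into A k)) = \<Union> (Y ` range (from_nat_into A))" by auto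
    also have "range (from_nat_into A) = A" by (rule range_from_nat_into[OF assms(2,1)])
    finally show ?thesis using assms(3) by simp
  qed
  then have "bowen_outer T f Z \<epsilon> b \<le> (\<Sum>k. bowen_outer T f (Y (from_nat_into A k)) \<epsilon> b)"
    by (rule bowen_outer_subadditive)
  also have "\<dots> = 0"
    using zero from_nat_into[OF assms(2)] by simp
  finally show ?thesis
    unfolding bowen_pressure_def by (intro INF_lower) auto
qed

lemma finite_stable_set_cover:
  fixes T :: "'a::metric_space \<Rightarrow> 'a"
  assumes "compact (UNIV :: 'a set)" "continuous_on UNIV T" "\<epsilon> > 0" "finite S"
  obtains A where "finite A" "UNIV \<subseteq> (\<Union>x\<in>A. stable_set T \<epsilon> S x)"
proof -
  \<comment> \<open>The strict inequality makes \<open>U x\<close> open, since \<open>S\<close> is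
    finite; it contains \<open>x\<close> and lies inside the stable set.\<close>
  define U where "U x = {y. \<forall>j\<in>S. dist ((T ^^ j) x) ((T ^^ j) y) < \<epsilon>}" for x
  have "U x = (\<Inter>j\<in>S. {y. dist ((T ^^ j) x) ((T ^^ j) y) < \<epsilon>})" for x
    by (auto simp: U_def)
  moreover have "open {y. dist ((T ^^ j) x) ((T ^^ j) y) < \<epsilon>}" for j x
    by (intro open_Collect_less continuous_intros continuous_on_funpow assms)
  ultimately have "open (U x)" for x
    using assms(4) by (simp add: open_INT)
  moreover have "UNIV \<subseteq> (\<Union>x\<in>UNIV. U x)"
    using assms(3) by (auto simp: U_def)
  ultimately obtain A where "finite A" "UNIV \<subseteq> (\<Union>x\<in>A. U x)"
    using compactE_image[OF assms(1), of UNIV U] by metis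
  moreover have "U x \<subseteq> stable_set T \<epsilon> S x" for x
    by (auto simp: U_def stable_set_def less_imp_le)
  ultimately show ?thesis using that[of A] by blast
qed

text \<open>If all pieces stayed strictly below, a real \<open>b\<close> would separate their
  maximum from the value on \<open>Z\<close>. Being finitely many, the pieces obey the bound by
  \<open>b\<close> simultaneously at all small radii, and then so does \<open>Z\<close>.\<close>

lemma bowen_upper_mdim_attained:
  fixes T :: "'a::metric_space \<Rightarrow> 'a"
  assumes "finite A" "A \<noteq> {}" "Z \<subseteq> (\<Union>a\<in>A. Y a)"
  shows "\<exists>a\<in>A. bowen_upper_mdim T f Z \<le> bowen_upper_mdim T f (Y a)"
proof (rule ccontr)
  assume "\<not> ?thesis"
  then have "Max ((\<lambda>a. bowen_upper_mdim T f (Y a)) ` A) < bowen_upper_mdim T f Z"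
    using assms by (subst Max_less_iff) (auto simp: not_le)
  then obtain b where b: "Max ((\<lambda>a. bowen_upper_mdim T f (Y a)) ` A) < ereal b"
    "ereal b < bowen_upper_mdim T f Z"
    using ereal_dense2 by blast
  have "eventually (\<lambda>\<epsilon>. bowen_pressure T f (Y a) \<epsilon> / ereal (ln (1 / \<epsilon>)) < ereal b) (at_right 0)"
    if "a \<in> A" for a
  proof (rule Limsup_lessD)
    show "Limsup (at_right 0) (\<lambda>\<epsilon>. bowen_pressure T f (Y a) \<epsilon> / ereal (ln (1 / \<epsilon>))) < ereal b"
      using b(1) assms that by (subst (asm) Max_less_iff) (auto simp: bowen_upper_mdim_def)
  qed
  then have "eventually (\<lambda>\<epsilon>. \<forall>a\<in>A. bowen_pressure T f (Y a) \<epsilon> / ereal (ln (1 / \<epsilon>)) < ereal b) (at_right 0)"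
    using assms(1) by (intro eventually_ball_finite) auto
  moreover have "eventually (\<lambda>\<epsilon>::real. 1 \<le> ln (1 / \<epsilon>)) (at_right 0)"
    by (rule eventually_ln_inverse_ge)
  ultimately have "eventually (\<lambda>\<epsilon>. bowen_pressure T f Z \<epsilon> / ereal (ln (1 / \<epsilon>)) \<le> ereal b) (at_right 0)"
  proof eventually_elim
    case (elim \<epsilon>)
    define l where "l = ln (1 / \<epsilon>)"
    have l: "1 \<le> l" using elim(2) by (simp add: l_def)
    have "bowen_pressure T f (Y a) \<epsilon> < ereal (l * b)" if "a \<in> A" for a
      using elim(1) that l unfolding l_def[symmetric] by (auto simp: ereal_divide_less_pos)
    then have "bowen_pressure T f Z \<epsilon> \<le> ereal (l * b)"
      using assms by (intro bowen_pressure_UN_le[of A Z Y]) (auto simp: countable_finite)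
    then show ?case
      using l unfolding l_def[symmetric] by (subst ereal_divide_le_pos) auto
  qed
  then have "bowen_upper_mdim T f Z \<le> ereal b"
    unfolding bowen_upper_mdim_def by (rule Limsup_bounded)
  with b(2) show False by simp
qed

text \<open>The loss \<open>ln 3 * F\<close> does not depend on the radius, so it is eventually
  below \<open>\<eta> * ln (1 / \<epsilon>)\<close>.\<close>

lemma bowen_upper_mdim_le_packing_upper_mdim:
  fixes T :: "'a::metric_space \<Rightarrow> 'a"
  assumes "compact (UNIV :: 'a set)" "continuous_on UNIV T" "\<And>x. \<bar>f x\<bar> \<le> F"
  shows "bowen_upper_mdim T f Z \<le> packing_upper_mdim T f Z"
  unfolding bowen_upper_mdim_def packing_upper_mdim_def
proof (rule Limsup_div_ln_le[of 3])
  fix \<eta> :: real assume "\<eta> > 0"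
  have "eventually (\<lambda>\<epsilon>::real. ln 3 * F / \<eta> \<le> ln (1 / \<epsilon>)) (at_right 0)"
    by (rule eventually_ln_inverse_ge)
  then show "eventually (\<lambda>\<epsilon>. bowen_pressure T f Z (3 * \<epsilon>)
      \<le> packing_pressure T f Z \<epsilon> + ereal (\<eta> * ln (1 / \<epsilon>))) (at_right 0)"
    using eventually_at_right_less[of 0]
  proof eventually_elim
    case (elim \<epsilon>)
    have "bowen_pressure T f Z (3 * \<epsilon>) \<le> packing_pressure T f Z \<epsilon> + ereal (ln 3 * F)"
      using elim assms by (intro bowen_pressure_le_packing_pressure) auto
    also have "\<dots> \<le> packing_pressure T f Z \<epsilon> + ereal (\<eta> * ln (1 / \<epsilon>))"
      using elim(1) \<open>\<eta> > 0\<close>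
      by (intro add_left_mono) (simp add: pos_divide_le_eq mult.commute)
    finally show ?case .
  qed
qed simp

lemma eventually_oscillation_le:
  fixes f :: "'a::metric_space \<Rightarrow> real"
  assumes "uniformly_continuous_on UNIV f" "\<eta> > 0"
  shows "eventually (\<lambda>\<epsilon>::real. \<forall>x y. dist x y \<le> \<epsilon> \<longrightarrow> f x \<le> f y + \<eta>) (at_right 0)"
proof -
  obtain d where d: "d > 0" "\<And>x y. dist x y < d \<Longrightarrow> dist (f x) (f y) < \<eta>"
    using assms unfolding uniformly_continuous_on_def by (metis UNIV_I dist_commute)
  show ?thesis
  proof (rule eventually_at_rightI[of 0 d], intro allI impI)
    fix \<epsilon> and x y :: 'a assume "\<epsilon> \<in> {0<..<d}" "dist x y \<le> \<epsilon>"
    then have "dist (f x) (f y) < \<eta>" by (intro d(2)) auto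
    then show "f x \<le> f y + \<eta>" by (simp add: dist_real_def)
  qed (rule d(1))
qed

lemma packing_upper_mdim_le_upper_mdim:
  assumes "uniformly_continuous_on UNIV f"
  shows "packing_upper_mdim T f Z \<le> upper_mdim T f Z"
  unfolding upper_mdim_def packing_upper_mdim_def
proof (rule Limsup_div_ln_le[of 1])
  fix \<eta> :: real assume "\<eta> > 0"
  \<comment> \<open>Half of \<open>\<eta>\<close>, because the comparison of pressures loses twice
    the oscillation.\<close>
  then have "eventually (\<lambda>\<epsilon>::real. \<forall>x y. dist x y \<le> \<epsilon> \<longrightarrow> f x \<le> f y + \<eta> / 2) (at_right 0)"
    using assms by (intro eventually_oscillation_le) auto
  moreover have "eventually (\<lambda>\<epsilon>::real. \<epsilon> \<in> {0<..<1}) (at_right 0)"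
    by (rule eventually_at_rightI[of 0 1]) auto
  ultimately show "eventually (\<lambda>\<epsilon>. packing_pressure T f Z (1 * \<epsilon>)
      \<le> span_pressure T f Z \<epsilon> + ereal (\<eta> * ln (1 / \<epsilon>))) (at_right 0)"
  proof eventually_elim
    case (elim \<epsilon>)
    then show ?case
      using packing_pressure_le_span_pressure[of \<epsilon> "\<eta> / 2" f T Z] \<open>\<eta> > 0\<close> by simp
  qed
qed simp

lemma upper_mdim_UNIV_le_bowen_upper_mdim:
  fixes T :: "'a::metric_space \<Rightarrow> 'a"
  assumes "compact (UNIV :: 'a set)" "continuous_on UNIV T"
    and "uniformly_continuous_on UNIV f" "\<And>x. \<bar>f x\<bar> \<le> F"
  shows "upper_mdim T f UNIV \<le> bowen_upper_mdim T f UNIV"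
  unfolding upper_mdim_def bowen_upper_mdim_def
proof (rule Limsup_div_ln_le[of 2])
  fix \<eta> :: real assume "\<eta> > 0"
  then have "eventually (\<lambda>\<epsilon>::real. \<forall>x y. dist x y \<le> \<epsilon> \<longrightarrow> f x \<le> f y + \<eta> / 2) (at_right 0)"
    using assms by (intro eventually_oscillation_le) auto
  moreover have "eventually (\<lambda>\<epsilon>::real. \<epsilon> \<in> {0<..<1}) (at_right 0)"
    by (rule eventually_at_rightI[of 0 1]) auto
  \<comment> \<open>One half of \<open>\<eta>\<close> covers the oscillation of \<open>f\<close>,
    the other the constant \<open>ln 2 * F\<close>.\<close>
  moreover have "eventually (\<lambda>\<epsilon>::real. ln 2 * F / (\<eta> / 2) \<le> ln (1 / \<epsilon>)) (at_right 0)"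
    by (rule eventually_ln_inverse_ge)
  ultimately show "eventually (\<lambda>\<epsilon>. span_pressure T f UNIV (2 * \<epsilon>)
      \<le> bowen_pressure T f UNIV \<epsilon> + ereal (\<eta> * ln (1 / \<epsilon>))) (at_right 0)"
  proof eventually_elim
    case (elim \<epsilon>)
    have "span_pressure T f UNIV (2 * \<epsilon>)
        \<le> bowen_pressure T f UNIV \<epsilon> + ereal (\<eta> / 2 * ln (1 / \<epsilon>) + ln 2 * F)"
      using elim(1,2) assms by (intro span_pressure_le_bowen_pressure) auto
    also have "\<dots> \<le> bowen_pressure T f UNIV \<epsilon> + ereal (\<eta> * ln (1 / \<epsilon>))"
    proof -
      have "ln 2 * F \<le> \<eta> / 2 * ln (1 / \<epsilon>)"
        using elim(3) \<open>\<eta> > 0\<close> by (subst (asm) pos_divide_le_eq) (auto simp: mult.commute)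
      then show ?thesis by (intro add_left_mono) simp
    qed
    finally show ?case .
  qed
qed simp

text \<open>A set spanning \<open>Z'\<close> also spans \<open>Z\<close>. Both divisions preserve
  the order only for \<open>n > 0\<close> and small radii, which the upper limits allow.\<close>

lemma upper_mdim_mono:
  assumes "Z \<subseteq> Z'"
  shows "upper_mdim T f Z \<le> upper_mdim T f Z'"
proof -
  have "span_sum T f Z \<epsilon> n \<le> span_sum T f Z' \<epsilon> n" for \<epsilon> n
    unfolding span_sum_def using assms by (intro INF_superset_mono) (auto simp: spanning_def subset_iff)
  then have "ln_ennreal (span_sum T f Z \<epsilon> n) / ereal (real n)
      \<le> ln_ennreal (span_sum T f Z' \<epsilon> n) / ereal (real n)" if "n > 0" for \<epsilon> n
    using that by (intro ereal_divide_right_mono ln_ennreal_mono) auto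
  then have "span_pressure T f Z \<epsilon> \<le> span_pressure T f Z' \<epsilon>" for \<epsilon>
    unfolding span_pressure_def
    by (intro Limsup_mono eventually_mono[OF eventually_gt_at_top[of 0]])
  moreover have "eventually (\<lambda>\<epsilon>::real. 1 \<le> ln (1 / \<epsilon>)) (at_right 0)"
    by (rule eventually_ln_inverse_ge)
  ultimately show ?thesis
    unfolding upper_mdim_def
    by (intro Limsup_mono) (auto elim!: eventually_mono intro!: ereal_divide_right_mono)
qed

theorem theorem1p1:
  fixes T :: "'a::metric_space \<Rightarrow> 'a" and f :: "'a \<Rightarrow> real" and \<epsilon> :: real and S :: "nat set"
  assumes "compact (UNIV :: 'a set)"
    and "continuous_on UNIV T"
    and "continuous_on UNIV f"
    and "\<epsilon> > 0"
    and "finite S"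
  shows "is_max_of (upper_mdim T f UNIV) (\<lambda>x. bowen_upper_mdim T f (stable_set T \<epsilon> S x)) \<and>
    is_max_of (upper_mdim T f UNIV) (\<lambda>x. packing_upper_mdim T f (stable_set T \<epsilon> S x)) \<and>
    is_max_of (upper_mdim T f UNIV) (\<lambda>x. upper_mdim T f (stable_set T \<epsilon> S x))"
proof -
  let ?W = "stable_set T \<epsilon> S"
  have unif: "uniformly_continuous_on UNIV f"
    using assms(3,1) by (rule compact_uniformly_continuous)
  have "bounded (range f)"
    using compact_continuous_image[OF assms(3,1)] by (rule compact_imp_bounded)
  then obtain F where F: "\<And>x. \<bar>f x\<bar> \<le> F"
    by (auto simp: bounded_iff)
  \<comment> \<open>This chain gives all upper bounds; a point where its smallest member reaches
    \<open>upper_mdim T f UNIV\<close> then serves for the three maxima at once.\<close>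
  have le: "bowen_upper_mdim T f Z \<le> packing_upper_mdim T f Z"
      "packing_upper_mdim T f Z \<le> upper_mdim T f Z"
      "upper_mdim T f Z \<le> upper_mdim T f UNIV" for Z
    using bowen_upper_mdim_le_packing_upper_mdim[OF assms(1,2) F]
      packing_upper_mdim_le_upper_mdim[OF unif] upper_mdim_mono[of Z UNIV] by auto
  obtain A where A: "finite A" "UNIV \<subseteq> (\<Union>x\<in>A. ?W x)"
    using finite_stable_set_cover[OF assms(1,2,4,5)] .
  then have "A \<noteq> {}" by auto
  then obtain x where "bowen_upper_mdim T f UNIV \<le> bowen_upper_mdim T f (?W x)"
    using bowen_upper_mdim_attained[OF A(1) _ A(2)] by blast
  then have "upper_mdim T f UNIV \<le> bowen_upper_mdim T f (?W x)"
    using upper_mdim_UNIV_le_bowen_upper_mdim[OF assms(1,2) unif F] by (rule order_trans[rotated])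
  then show ?thesis
    using le unfolding is_max_of_def by (meson order_antisym order_trans)
qed

end
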